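(* Let $\mathsf{A}$ be an abelian category, $\mathsf{W}$ a special precovering subcategory of $\mathsf{A}$, and $\mathrm{G}$ a covariant additive functor from $\mathsf{A}$ to the category $\mathsf{Ab}$ of abelian groups which is half $\operatorname{Hom}_{\mathsf{A}}(\mathsf{W},-)$-exact. Then the following statements are equivalent: (i) The $\mathsf{W}$-stable functor $\underline{\mathrm{G}}^{\mathsf{W}}$ is right $\operatorname{Hom}_{\mathsf{A}}(\mathsf{W},-)$-exact. (ii) $\underline{\mathrm{G}}^{\mathsf{W}}=0$. (iii) $\mathrm{G}$ is right $\operatorname{Hom}_{\mathsf{A}}(\mathsf{W},-)$-exact.
   Context: "Subcategory" means a full additive subcategory closed under isomorphisms; Ext is Yoneda Ext. $\mathsf{W}^{\perp}=\{N\mid\operatorname{Ext}^1_{\mathsf{A}}(W,N)=0\ \forall W\in\mathsf{W}\}$. $\mathsf{W}$ is special precovering if every object $M$ admits an exact sequence $0\to K\to W\to M\to0$ with $W\in\mathsf{W}$, $K\in\mathsf{W}^{\perp}$ (a special $\mathsf{W}$-precover). A sequence is $\operatorname{Hom}_{\mathsf{A}}(\mathsf{W},-)$-exact if it stays exact under $\operatorname{Hom}_{\mathsf{A}}(W,-)$ for all $W\in\mathsf{W}$. A proper $\mathsf{W}$-resolution of $N$ is a complex $P=(\cdots\to P_1\to P_0\to0)$ of objects in $\mathsf{W}$ with a $\operatorname{Hom}_{\mathsf{A}}(\mathsf{W},-)$-exact exact sequence $\cdots\to P_1\to P_0\xrightarrow{f}N\to0$. Put $\mathrm{L}_0^{\mathsf{W}}\mathrm{G}(N)=\mathrm{H}_0(\mathrm{G}(P))=\operatorname{Coker}(\mathrm{G}(P_1)\to\mathrm{G}(P_0))$.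 $\mathrm{G}(f)$ induces a natural transformation $\varrho\colon\mathrm{L}_0^{\mathsf{W}}\mathrm{G}\to\mathrm{G}$, and $\underline{\mathrm{G}}^{\mathsf{W}}=\operatorname{Coker}\varrho$ is the $\mathsf{W}$-stable functor of $\mathrm{G}$ (independent of choices). A covariant additive functor $\mathrm{G}$ is half (resp. right) $\operatorname{Hom}_{\mathsf{A}}(\mathsf{W},-)$-exact if for each $\operatorname{Hom}_{\mathsf{A}}(\mathsf{W},-)$-exact short exact sequence $0\to A'\to A\to A''\to0$ the sequence $\mathrm{G}(A')\to\mathrm{G}(A)\to\mathrm{G}(A'')$ (resp. $\mathrm{G}(A')\to\mathrm{G}(A)\to\mathrm{G}(A'')\to0$) is exact. *)

theory Defs
  imports "HOL-Algebra.Exact_Sequence"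
begin

section \<open>Abelian categories\<close>

text \<open>
  A category enriched in abelian groups is given by its objects, its arrows with their source and
  target, identities, composition (\<open>g \<cdot> f\<close> is \<open>g\<close> after \<open>f\<close>), addition of parallel arrows and zero
  arrows.
\<close>

record ('o, 'm) ab_cat =
  Ob :: "'o set"
  Arr :: "'m set"
  Src :: "'m \<Rightarrow> 'o"
  Tgt :: "'m \<Rightarrow> 'o"
  Idn :: "'o \<Rightarrow> 'm"
  Comp :: "'m \<Rightarrow> 'm \<Rightarrow> 'm"  (infixl \<open>\<cdot>\<index>\<close> 70)
  Plus :: "'m \<Rightarrow> 'm \<Rightarrow> 'm"  (infixl \<open>\<boxplus>\<index>\<close> 65)
  Nul :: "'o \<Rightarrow> 'o \<Rightarrow> 'm"

definition hom_grp :: "('o, 'm) ab_cat \<Rightarrow> 'o \<Rightarrow> 'o \<Rightarrow> 'm monoid" where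
  "hom_grp A a b = \<lparr>carrier = {f \<in> Arr A. Src A f = a \<and> Tgt A f = b}, mult = Plus A, one = Nul A a b\<rparr>"

abbreviation hom_set :: "('o, 'm) ab_cat \<Rightarrow> 'o \<Rightarrow> 'o \<Rightarrow> 'm set" where
  "hom_set A a b \<equiv> carrier (hom_grp A a b)"

locale category =
  fixes A :: "('o, 'm) ab_cat" (structure)
  assumes Src_in_Ob: "f \<in> Arr A \<Longrightarrow> Src A f \<in> Ob A"
    and Tgt_in_Ob: "f \<in> Arr A \<Longrightarrow> Tgt A f \<in> Ob A"
    and Idn_in_hom: "a \<in> Ob A \<Longrightarrow> Idn A a \<in> hom_set A a a"
    and Comp_in_hom: "\<lbrakk>f \<in> hom_set A a b; g \<in> hom_set A b c\<rbrakk> \<Longrightarrow> g \<cdot> f \<in> hom_set A a c"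
    and Comp_Idn: "f \<in> hom_set A a b \<Longrightarrow> f \<cdot> Idn A a = f"
    and Idn_Comp: "f \<in> hom_set A a b \<Longrightarrow> Idn A b \<cdot> f = f"
    and Comp_assoc: "\<lbrakk>f \<in> hom_set A a b; g \<in> hom_set A b c; h \<in> hom_set A c d\<rbrakk>
      \<Longrightarrow> (h \<cdot> g) \<cdot> f = h \<cdot> (g \<cdot> f)"

locale preadditive_category = category +
  assumes comm_group_hom: "\<lbrakk>a \<in> Ob A; b \<in> Ob A\<rbrakk> \<Longrightarrow> comm_group (hom_grp A a b)"
    and Comp_Plus: "\<lbrakk>f \<in> hom_set A a b; f' \<in> hom_set A a b; g \<in> hom_set A b c\<rbrakk>
      \<Longrightarrow> g \<cdot> (f \<boxplus> f') = (g \<cdot> f) \<boxplus> (g \<cdot> f')"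
    and Plus_Comp: "\<lbrakk>f \<in> hom_set A a b; g \<in> hom_set A b c; g' \<in> hom_set A b c\<rbrakk>
      \<Longrightarrow> (g \<boxplus> g') \<cdot> f = (g \<cdot> f) \<boxplus> (g' \<cdot> f)"

definition zero_object :: "('o, 'm) ab_cat \<Rightarrow> 'o \<Rightarrow> bool" where
  "zero_object A z \<longleftrightarrow> z \<in> Ob A \<and>
    (\<forall>x\<in>Ob A. (\<exists>!f. f \<in> hom_set A x z) \<and> (\<exists>!f. f \<in> hom_set A z x))"

definition biproduct :: "('o, 'm) ab_cat \<Rightarrow> 'o \<Rightarrow> 'o \<Rightarrow> 'o \<Rightarrow> bool" where
  "biproduct A x y s \<longleftrightarrow> (\<exists>i\<in>hom_set A x s. \<exists>j\<in>hom_set A y s. \<exists>p\<in>hom_set A s x. \<exists>q\<in>hom_set A s y.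
    p \<cdot>\<^bsub>A\<^esub> i = Idn A x \<and> q \<cdot>\<^bsub>A\<^esub> j = Idn A y \<and> p \<cdot>\<^bsub>A\<^esub> j = Nul A y x \<and> q \<cdot>\<^bsub>A\<^esub> i = Nul A x y \<and>
    (i \<cdot>\<^bsub>A\<^esub> p) \<boxplus>\<^bsub>A\<^esub> (j \<cdot>\<^bsub>A\<^esub> q) = Idn A s)"

definition is_iso :: "('o, 'm) ab_cat \<Rightarrow> 'm \<Rightarrow> bool" where
  "is_iso A f \<longleftrightarrow> f \<in> Arr A \<and> (\<exists>g\<in>hom_set A (Tgt A f) (Src A f).
    g \<cdot>\<^bsub>A\<^esub> f = Idn A (Src A f) \<and> f \<cdot>\<^bsub>A\<^esub> g = Idn A (Tgt A f))"

definition is_mono :: "('o, 'm) ab_cat \<Rightarrow> 'm \<Rightarrow> bool" where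
  "is_mono A f \<longleftrightarrow> f \<in> Arr A \<and> (\<forall>x\<in>Ob A. inj_on (Comp A f) (hom_set A x (Src A f)))"

definition is_epi :: "('o, 'm) ab_cat \<Rightarrow> 'm \<Rightarrow> bool" where
  "is_epi A f \<longleftrightarrow> f \<in> Arr A \<and> (\<forall>x\<in>Ob A. inj_on (\<lambda>g. g \<cdot>\<^bsub>A\<^esub> f) (hom_set A (Tgt A f) x))"

definition is_kernel :: "('o, 'm) ab_cat \<Rightarrow> 'm \<Rightarrow> 'm \<Rightarrow> bool" where
  "is_kernel A k f \<longleftrightarrow> f \<in> Arr A \<and> k \<in> Arr A \<and> Tgt A k = Src A f \<and>
    f \<cdot>\<^bsub>A\<^esub> k = Nul A (Src A k) (Tgt A f) \<and>
    (\<forall>x\<in>Ob A. \<forall>h\<in>hom_set A x (Src A f). f \<cdot>\<^bsub>A\<^esub> h = Nul A x (Tgt A f) \<longrightarrow>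
      (\<exists>!u. u \<in> hom_set A x (Src A k) \<and> k \<cdot>\<^bsub>A\<^esub> u = h))"

definition is_cokernel :: "('o, 'm) ab_cat \<Rightarrow> 'm \<Rightarrow> 'm \<Rightarrow> bool" where
  "is_cokernel A c f \<longleftrightarrow> f \<in> Arr A \<and> c \<in> Arr A \<and> Src A c = Tgt A f \<and>
    c \<cdot>\<^bsub>A\<^esub> f = Nul A (Src A f) (Tgt A c) \<and>
    (\<forall>x\<in>Ob A. \<forall>h\<in>hom_set A (Tgt A f) x. h \<cdot>\<^bsub>A\<^esub> f = Nul A (Src A f) x \<longrightarrow>
      (\<exists>!u. u \<in> hom_set A (Tgt A c) x \<and> u \<cdot>\<^bsub>A\<^esub> c = h))"

locale abelian_category = preadditive_category +
  assumes ex_zero_object: "\<exists>z. zero_object A z"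
    and ex_biproduct: "\<lbrakk>x \<in> Ob A; y \<in> Ob A\<rbrakk> \<Longrightarrow> \<exists>s. biproduct A x y s"
    and ex_kernel: "f \<in> Arr A \<Longrightarrow> \<exists>k. is_kernel A k f"
    and ex_cokernel: "f \<in> Arr A \<Longrightarrow> \<exists>c. is_cokernel A c f"
    and mono_is_kernel: "is_mono A m \<Longrightarrow> \<exists>f. is_kernel A m f"
    and epi_is_cokernel: "is_epi A e \<Longrightarrow> \<exists>f. is_cokernel A e f"


section \<open>Exact sequences and Yoneda Ext\<close>

text \<open>The image of an arrow is the kernel of its cokernel.\<close>

definition is_image :: "('o, 'm) ab_cat \<Rightarrow> 'm \<Rightarrow> 'm \<Rightarrow> bool" where
  "is_image A m f \<longleftrightarrow> (\<exists>c. is_cokernel A c f \<and> is_kernel A m c)"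

definition exact_at :: "('o, 'm) ab_cat \<Rightarrow> 'm \<Rightarrow> 'm \<Rightarrow> bool" where
  "exact_at A f g \<longleftrightarrow> (\<exists>m. is_image A m f \<and> is_kernel A m g)"

definition short_exact :: "('o, 'm) ab_cat \<Rightarrow> 'm \<Rightarrow> 'm \<Rightarrow> bool" where
  "short_exact A f g \<longleftrightarrow> (\<exists>z. zero_object A z \<and>
    exact_at A (Nul A z (Src A f)) f \<and> exact_at A f g \<and> exact_at A g (Nul A (Tgt A g) z))"

text \<open>An extension \<open>0 \<rightarrow> N \<rightarrow> E \<rightarrow> X \<rightarrow> 0\<close> is represented by its two inner arrows.\<close>

definition extensions :: "('o, 'm) ab_cat \<Rightarrow> 'o \<Rightarrow> 'o \<Rightarrow> ('m \<times> 'm) set" where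
  "extensions A X N = {(i, p). short_exact A i p \<and> Src A i = N \<and> Tgt A p = X}"

definition ext_equiv :: "('o, 'm) ab_cat \<Rightarrow> 'o \<Rightarrow> 'o \<Rightarrow> (('m \<times> 'm) \<times> ('m \<times> 'm)) set" where
  "ext_equiv A X N = {((i, p), (i', p')). (i, p) \<in> extensions A X N \<and> (i', p') \<in> extensions A X N \<and>
    (\<exists>h\<in>hom_set A (Tgt A i) (Tgt A i'). is_iso A h \<and> h \<cdot>\<^bsub>A\<^esub> i = i' \<and> p' \<cdot>\<^bsub>A\<^esub> h = p)}"

definition Ext1 :: "('o, 'm) ab_cat \<Rightarrow> 'o \<Rightarrow> 'o \<Rightarrow> ('m \<times> 'm) set set" where
  "Ext1 A X N = extensions A X N // ext_equiv A X N"

text \<open>The zero element of the Yoneda Ext group is the class of the split extensions.\<close>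

definition Ext1_zero :: "('o, 'm) ab_cat \<Rightarrow> 'o \<Rightarrow> 'o \<Rightarrow> ('m \<times> 'm) set" where
  "Ext1_zero A X N =
    {(i, p) \<in> extensions A X N. \<exists>s\<in>hom_set A X (Src A p). p \<cdot>\<^bsub>A\<^esub> s = Idn A X}"


section \<open>Special precovering subcategories\<close>

text \<open>A full subcategory is identified with its set of objects.\<close>

definition subcategory :: "('o, 'm) ab_cat \<Rightarrow> 'o set \<Rightarrow> bool" where
  "subcategory A W \<longleftrightarrow> W \<subseteq> Ob A \<and>
    (\<forall>h. is_iso A h \<and> Src A h \<in> W \<longrightarrow> Tgt A h \<in> W) \<and>
    (\<exists>z\<in>W. zero_object A z) \<and>
    (\<forall>x\<in>W. \<forall>y\<in>W. \<exists>s\<in>W. biproduct A x y s)"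

definition right_perp :: "('o, 'm) ab_cat \<Rightarrow> 'o set \<Rightarrow> 'o set" where
  "right_perp A W = {N \<in> Ob A. \<forall>X\<in>W. Ext1 A X N = {Ext1_zero A X N}}"

definition special_precovering :: "('o, 'm) ab_cat \<Rightarrow> 'o set \<Rightarrow> bool" where
  "special_precovering A W \<longleftrightarrow> subcategory A W \<and>
    (\<forall>M\<in>Ob A. \<exists>k p. short_exact A k p \<and> Tgt A p = M \<and> Src A p \<in> W \<and> Src A k \<in> right_perp A W)"


section \<open>Functors to abelian groups\<close>

record ('o, 'm, 'g) ab_functor =
  OMap :: "'o \<Rightarrow> 'g monoid"
  AMap :: "'m \<Rightarrow> 'g \<Rightarrow> 'g"

definition additive_functor :: "('o, 'm) ab_cat \<Rightarrow> ('o, 'm, 'g) ab_functor \<Rightarrow> bool" where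
  "additive_functor A G \<longleftrightarrow>
    (\<forall>a\<in>Ob A. comm_group (OMap G a)) \<and>
    (\<forall>a\<in>Ob A. \<forall>b\<in>Ob A. \<forall>f\<in>hom_set A a b. AMap G f \<in> hom (OMap G a) (OMap G b)) \<and>
    (\<forall>a\<in>Ob A. \<forall>x\<in>carrier (OMap G a). AMap G (Idn A a) x = x) \<and>
    (\<forall>a\<in>Ob A. \<forall>b\<in>Ob A. \<forall>c\<in>Ob A. \<forall>f\<in>hom_set A a b. \<forall>g\<in>hom_set A b c. \<forall>x\<in>carrier (OMap G a).
      AMap G (g \<cdot>\<^bsub>A\<^esub> f) x = AMap G g (AMap G f x)) \<and>
    (\<forall>a\<in>Ob A. \<forall>b\<in>Ob A. \<forall>f\<in>hom_set A a b. \<forall>f'\<in>hom_set A a b. \<forall>x\<in>carrier (OMap G a).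
      AMap G (f \<boxplus>\<^bsub>A\<^esub> f') x = AMap G f x \<otimes>\<^bsub>OMap G b\<^esub> AMap G f' x)"

definition zero_functor :: "('o, 'm) ab_cat \<Rightarrow> ('o, 'm, 'g) ab_functor \<Rightarrow> bool" where
  "zero_functor A G \<longleftrightarrow> (\<forall>N\<in>Ob A. trivial_group (OMap G N))"

text \<open>
  Exactness of \<open>H \<rightarrow> K \<rightarrow> L \<rightarrow> 0\<close> for groups; as in \<^const>\<open>exact_seq\<close>, the last group and the
  last map come first.
\<close>

definition right_exact_seq ::
    "'g monoid \<Rightarrow> 'g monoid \<Rightarrow> 'g monoid \<Rightarrow> ('g \<Rightarrow> 'g) \<Rightarrow> ('g \<Rightarrow> 'g) \<Rightarrow> bool" where
  "right_exact_seq L K H g f \<longleftrightarrow> (\<exists>T e. exact_seq ([T, L, K, H], [e, g, f]) \<and> trivial_group T)"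

text \<open>The short exact sequences \<open>0 \<rightarrow> A' \<rightarrow> A \<rightarrow> A'' \<rightarrow> 0\<close> that stay (short) exact under \<open>Hom(X, -)\<close>.\<close>

definition Hom_short_exact :: "('o, 'm) ab_cat \<Rightarrow> 'o set \<Rightarrow> 'm \<Rightarrow> 'm \<Rightarrow> bool" where
  "Hom_short_exact A W f g \<longleftrightarrow> short_exact A f g \<and>
    (\<forall>X\<in>W. short_exact_sequence
      (hom_grp A X (Tgt A g)) (hom_grp A X (Src A g)) (hom_grp A X (Src A f)) (Comp A g) (Comp A f))"

definition half_exact :: "('o, 'm) ab_cat \<Rightarrow> 'o set \<Rightarrow> ('o, 'm, 'g) ab_functor \<Rightarrow> bool" where
  "half_exact A W G \<longleftrightarrow> (\<forall>f g. Hom_short_exact A W f g \<longrightarrow>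
    exact_seq ([OMap G (Tgt A g), OMap G (Src A g), OMap G (Src A f)], [AMap G g, AMap G f]))"

definition right_exact :: "('o, 'm) ab_cat \<Rightarrow> 'o set \<Rightarrow> ('o, 'm, 'g) ab_functor \<Rightarrow> bool" where
  "right_exact A W G \<longleftrightarrow> (\<forall>f g. Hom_short_exact A W f g \<longrightarrow>
    right_exact_seq (OMap G (Tgt A g)) (OMap G (Src A g)) (OMap G (Src A f)) (AMap G g) (AMap G f))"


section \<open>The stable functor\<close>

text \<open>
  An augmented resolution \<open>\<dots> \<rightarrow> P\<^sub>1 \<rightarrow> P\<^sub>0 \<rightarrow> N \<rightarrow> 0\<close> is represented by the sequence of its arrows:
  \<open>\<delta> 0\<close> is the augmentation \<open>P\<^sub>0 \<rightarrow> N\<close> and \<open>\<delta> (Suc n)\<close> is the differential \<open>P\<^bsub>n+1\<^esub> \<rightarrow> P\<^sub>n\<close>,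
  so that \<open>P\<^sub>n\<close> is the source of \<open>\<delta> n\<close>.
\<close>

definition proper_resolution ::
    "('o, 'm) ab_cat \<Rightarrow> 'o set \<Rightarrow> 'o \<Rightarrow> (nat \<Rightarrow> 'm) \<Rightarrow> bool" where
  "proper_resolution A W N \<delta> \<longleftrightarrow>
    (\<forall>n. \<delta> n \<in> Arr A \<and> Src A (\<delta> n) \<in> W) \<and> Tgt A (\<delta> 0) = N \<and>
    (\<exists>z. zero_object A z \<and> exact_at A (\<delta> 0) (Nul A N z)) \<and>
    (\<forall>n. exact_at A (\<delta> (Suc n)) (\<delta> n)) \<and>
    (\<forall>X\<in>W.
      right_exact_seq (hom_grp A X N) (hom_grp A X (Src A (\<delta> 0))) (hom_grp A X (Src A (\<delta> 1)))
        (Comp A (\<delta> 0)) (Comp A (\<delta> 1)) \<and>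
      (\<forall>n. exact_seq
        ([hom_grp A X (Tgt A (\<delta> n)), hom_grp A X (Src A (\<delta> n)), hom_grp A X (Src A (\<delta> (Suc n)))],
         [Comp A (\<delta> n), Comp A (\<delta> (Suc n))])))"

text \<open>A choice of a proper resolution; one exists for every object if \<open>W\<close> is special precovering.\<close>

definition resolution :: "('o, 'm) ab_cat \<Rightarrow> 'o set \<Rightarrow> 'o \<Rightarrow> nat \<Rightarrow> 'm" where
  "resolution A W N = (SOME \<delta>. proper_resolution A W N \<delta>)"

text \<open>
  The cokernel of \<open>\<phi> : H \<rightarrow> K\<close>, the map out of it induced by a map \<open>h\<close> on \<open>K\<close> that is constant on
  cosets, and the map between cokernels of \<open>\<phi>\<close> and \<open>\<phi>' : H' \<rightarrow> K'\<close> induced by \<open>h : K \<rightarrow> K'\<close>.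
\<close>

definition ab_coker :: "'h monoid \<Rightarrow> 'g monoid \<Rightarrow> ('h \<Rightarrow> 'g) \<Rightarrow> 'g set monoid" where
  "ab_coker H K \<phi> = K Mod (\<phi> ` carrier H)"

definition ab_coker_elim :: "('g \<Rightarrow> 'k) \<Rightarrow> 'g set \<Rightarrow> 'k" where
  "ab_coker_elim h c = the_elem (h ` c)"

definition ab_coker_map ::
    "'h monoid \<Rightarrow> 'k monoid \<Rightarrow> ('h \<Rightarrow> 'k) \<Rightarrow> ('g \<Rightarrow> 'k) \<Rightarrow> 'g set \<Rightarrow> 'k set" where
  "ab_coker_map H' K' \<phi>' h = ab_coker_elim (\<lambda>x. (\<phi>' ` carrier H') #>\<^bsub>K'\<^esub> h x)"

text \<open>
  The functor \<open>L\<^sub>0G\<close>. Its value at \<open>h : N \<rightarrow> N'\<close> is induced by the degree zero component \<open>P\<^sub>0 \<rightarrow> P\<^sub>0'\<close> of a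
  lift of \<open>h\<close> to the resolutions.
\<close>

definition L0 ::
    "('o, 'm) ab_cat \<Rightarrow> 'o set \<Rightarrow> ('o, 'm, 'g) ab_functor \<Rightarrow> ('o, 'm, 'g set) ab_functor" where
  "L0 A W G =
    \<lparr>OMap = \<lambda>N. let \<delta> = resolution A W N in
       ab_coker (OMap G (Src A (\<delta> 1))) (OMap G (Src A (\<delta> 0))) (AMap G (\<delta> 1)),
     AMap = \<lambda>h. let \<delta> = resolution A W (Src A h); \<delta>' = resolution A W (Tgt A h);
         h\<^sub>0 = (SOME h\<^sub>0. h\<^sub>0 \<in> hom_set A (Src A (\<delta> 0)) (Src A (\<delta>' 0)) \<and> \<delta>' 0 \<cdot>\<^bsub>A\<^esub> h\<^sub>0 = h \<cdot>\<^bsub>A\<^esub> \<delta> 0) in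
       ab_coker_map (OMap G (Src A (\<delta>' 1))) (OMap G (Src A (\<delta>' 0))) (AMap G (\<delta>' 1)) (AMap G h\<^sub>0)\<rparr>"

definition rho ::
    "('o, 'm) ab_cat \<Rightarrow> 'o set \<Rightarrow> ('o, 'm, 'g) ab_functor \<Rightarrow> 'o \<Rightarrow> 'g set \<Rightarrow> 'g" where
  "rho A W G N = ab_coker_elim (AMap G (resolution A W N 0))"

text \<open>The cokernel of a natural transformation \<open>\<phi> : F \<rightarrow> G\<close> is formed objectwise.\<close>

definition coker_functor ::
    "('o, 'm) ab_cat \<Rightarrow> ('o, 'm, 'h) ab_functor \<Rightarrow> ('o, 'm, 'g) ab_functor \<Rightarrow>
      ('o \<Rightarrow> 'h \<Rightarrow> 'g) \<Rightarrow> ('o, 'm, 'g set) ab_functor" where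
  "coker_functor A F G \<phi> =
    \<lparr>OMap = \<lambda>N. ab_coker (OMap F N) (OMap G N) (\<phi> N),
     AMap = \<lambda>h. ab_coker_map (OMap F (Tgt A h)) (OMap G (Tgt A h)) (\<phi> (Tgt A h)) (AMap G h)\<rparr>"

definition stable_functor ::
    "('o, 'm) ab_cat \<Rightarrow> 'o set \<Rightarrow> ('o, 'm, 'g) ab_functor \<Rightarrow> ('o, 'm, 'g set) ab_functor" where
  "stable_functor A W G = coker_functor A (L0 A W G) G (rho A W G)"

end

theory Submission
  imports Defs
begin

text \<open>
  The image of \<open>G p\<close> is the same for all precovers \<open>p : X \<rightarrow> N\<close> with \<open>X \<in> W\<close>, so the stable functor
  takes \<open>N\<close> to the cokernel of \<open>G p\<close> for any such \<open>p\<close>; in particular it vanishes on \<open>W\<close>. Since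
  \<open>Ext\<^sup>1(W, K) = 0\<close>, a special precover \<open>0 \<rightarrow> K \<rightarrow> X \<rightarrow> N \<rightarrow> 0\<close> stays exact under \<open>Hom(W, -)\<close>, and right
  exactness of \<open>G\<close>, or of the stable functor, forces the stable functor to vanish at \<open>N\<close>. Conversely,
  if it vanishes and \<open>B \<rightarrow> N\<close> is surjective under \<open>Hom(W, -)\<close>, a precover \<open>p\<close> of \<open>N\<close> factors through
  \<open>B\<close>, so that \<open>G B \<rightarrow> G N\<close> is surjective because \<open>G p\<close> is.
\<close>

section \<open>Kernels, monomorphisms and epimorphisms\<close>

lemma hom_set_iff: "f \<in> hom_set A a b \<longleftrightarrow> f \<in> Arr A \<and> Src A f = a \<and> Tgt A f = b"
  by (simp add: hom_grp_def)

lemma mult_hom_grp [simp]: "mult (hom_grp A a b) = Plus A"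
  and one_hom_grp [simp]: "one (hom_grp A a b) = Nul A a b"
  by (simp_all add: hom_grp_def)

context category
begin

lemma arr_in_hom: "f \<in> Arr A \<Longrightarrow> f \<in> hom_set A (Src A f) (Tgt A f)"
  by (simp add: hom_set_iff)

lemma hom_Ob: "f \<in> hom_set A a b \<Longrightarrow> a \<in> Ob A \<and> b \<in> Ob A"
  using Src_in_Ob Tgt_in_Ob by (auto simp: hom_set_iff)

lemma monoD:
  assumes "is_mono A m" "m \<in> hom_set A a b" "u \<in> hom_set A x a" "v \<in> hom_set A x a" "m \<cdot> u = m \<cdot> v"
  shows "u = v"
  using assms hom_Ob[of u x a] by (auto simp: is_mono_def hom_set_iff inj_on_def)

lemma monoI:
  assumes "m \<in> hom_set A a b"
    "\<And>x u v. \<lbrakk>u \<in> hom_set A x a; v \<in> hom_set A x a; m \<cdot> u = m \<cdot> v\<rbrakk> \<Longrightarrow> u = v"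
  shows "is_mono A m"
  using assms by (auto simp: is_mono_def hom_set_iff inj_on_def)

lemma epiD:
  assumes "is_epi A e" "e \<in> hom_set A a b" "u \<in> hom_set A b x" "v \<in> hom_set A b x" "u \<cdot> e = v \<cdot> e"
  shows "u = v"
  using assms hom_Ob[of u b x] by (auto simp: is_epi_def hom_set_iff inj_on_def)

lemma kernel_arr:
  assumes "is_kernel A k f"
  shows "k \<in> hom_set A (Src A k) (Src A f)" "f \<in> hom_set A (Src A f) (Tgt A f)"
    "f \<cdot> k = Nul A (Src A k) (Tgt A f)"
  using assms by (auto simp: is_kernel_def hom_set_iff)

lemma kernel_factor:
  assumes "is_kernel A k f" "f \<in> hom_set A a b" "h \<in> hom_set A x a" "f \<cdot> h = Nul A x b"
  obtains u where "u \<in> hom_set A x (Src A k)" "k \<cdot> u = h"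
proof -
  have "\<exists>!u. u \<in> hom_set A x (Src A k) \<and> k \<cdot> u = h"
    using assms hom_Ob[OF assms(3)] unfolding is_kernel_def by (metis hom_set_iff)
  then show thesis using that by blast
qed

text \<open>Uniqueness of the factorisation is automatic for a monic \<open>k\<close>, so only its
  existence has to be supplied. \<open>cokernelI\<close> is the dual.\<close>

lemma kernelI:
  assumes "is_mono A k" "k \<in> hom_set A c a" "f \<in> hom_set A a b" "f \<cdot> k = Nul A c b"
    "\<And>x h. \<lbrakk>h \<in> hom_set A x a; f \<cdot> h = Nul A x b\<rbrakk> \<Longrightarrow> \<exists>u \<in> hom_set A x c. k \<cdot> u = h"
  shows "is_kernel A k f"
proof -
  have *: "Src A k = c" "Tgt A k = a" "Src A f = a" "Tgt A f = b"
    using assms by (auto simp: hom_set_iff)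
  have ex: "\<exists>!u. u \<in> hom_set A x c \<and> k \<cdot> u = h" if "h \<in> hom_set A x a" "f \<cdot> h = Nul A x b" for x h
    using assms(5)[OF that] monoD[OF assms(1,2)] by blast
  then show ?thesis
    unfolding is_kernel_def *
    by (intro conjI ballI impI ex) (use assms(2-4) in \<open>simp_all add: hom_set_iff\<close>)
qed

lemma cokernel_arr:
  assumes "is_cokernel A c f"
  shows "c \<in> hom_set A (Tgt A f) (Tgt A c)" "f \<in> hom_set A (Src A f) (Tgt A f)"
    "c \<cdot> f = Nul A (Src A f) (Tgt A c)"
  using assms by (auto simp: is_cokernel_def hom_set_iff)

lemma cokernel_factor:
  assumes "is_cokernel A c f" "f \<in> hom_set A a b" "h \<in> hom_set A b x" "h \<cdot> f = Nul A a x"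
  obtains u where "u \<in> hom_set A (Tgt A c) x" "u \<cdot> c = h"
proof -
  have "\<exists>!u. u \<in> hom_set A (Tgt A c) x \<and> u \<cdot> c = h"
    using assms hom_Ob[OF assms(3)] unfolding is_cokernel_def by (metis hom_set_iff)
  then show thesis using that by blast
qed

lemma cokernelI:
  assumes "is_epi A c" "c \<in> hom_set A b d" "f \<in> hom_set A a b" "c \<cdot> f = Nul A a d"
    "\<And>x h. \<lbrakk>h \<in> hom_set A b x; h \<cdot> f = Nul A a x\<rbrakk> \<Longrightarrow> \<exists>u \<in> hom_set A d x. u \<cdot> c = h"
  shows "is_cokernel A c f"
proof -
  have *: "Src A c = b" "Tgt A c = d" "Src A f = a" "Tgt A f = b"
    using assms by (auto simp: hom_set_iff)
  have ex: "\<exists>!u. u \<in> hom_set A d x \<and> u \<cdot> c = h" if "h \<in> hom_set A b x" "h \<cdot> f = Nul A a x" for x h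
    using assms(5)[OF that] epiD[OF assms(1,2)] by blast
  then show ?thesis
    unfolding is_cokernel_def *
    by (intro conjI ballI impI ex) (use assms(2-4) in \<open>simp_all add: hom_set_iff\<close>)
qed

lemma Idn_mono: "a \<in> Ob A \<Longrightarrow> is_mono A (Idn A a)"
  by (rule monoI[OF Idn_in_hom]) (auto simp: Idn_Comp)

lemma Idn_epi: "a \<in> Ob A \<Longrightarrow> is_epi A (Idn A a)"
  using Idn_in_hom[of a] by (auto simp: is_epi_def inj_on_def hom_set_iff Comp_Idn)

end

section \<open>Zero arrows, cancellation, and kernels and cokernels of composites\<close>

context preadditive_category
begin

lemma hom_grp_group: "\<lbrakk>a \<in> Ob A; b \<in> Ob A\<rbrakk> \<Longrightarrow> group (hom_grp A a b)"
  using comm_group_hom comm_group.axioms(2) by blast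

lemma Nul_in_hom: "\<lbrakk>a \<in> Ob A; b \<in> Ob A\<rbrakk> \<Longrightarrow> Nul A a b \<in> hom_set A a b"
  using monoid.one_closed[OF group.is_monoid[OF hom_grp_group]] by fastforce

lemma Plus_in_hom: "\<lbrakk>f \<in> hom_set A a b; g \<in> hom_set A a b\<rbrakk> \<Longrightarrow> f \<boxplus> g \<in> hom_set A a b"
  using monoid.m_closed[OF group.is_monoid[OF hom_grp_group]] hom_Ob[of f a b] by fastforce

lemma Comp_group_hom:
  assumes "g \<in> hom_set A b c" "a \<in> Ob A"
  shows "group_hom (hom_grp A a b) (hom_grp A a c) (Comp A g)"
  using assms hom_Ob[OF assms(1)]
  by (intro group_hom.intro group_hom_axioms.intro hom_grp_group homI) (auto intro: Comp_in_hom Comp_Plus)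

lemma Comp_right_group_hom:
  assumes "f \<in> hom_set A a b" "c \<in> Ob A"
  shows "group_hom (hom_grp A b c) (hom_grp A a c) (\<lambda>g. g \<cdot> f)"
  using assms hom_Ob[OF assms(1)]
  by (intro group_hom.intro group_hom_axioms.intro hom_grp_group homI) (auto intro: Comp_in_hom Plus_Comp)

lemma Comp_Nul: "\<lbrakk>g \<in> hom_set A b c; a \<in> Ob A\<rbrakk> \<Longrightarrow> g \<cdot> Nul A a b = Nul A a c"
  using group_hom.hom_one[OF Comp_group_hom] by fastforce

lemma Nul_Comp: "\<lbrakk>f \<in> hom_set A a b; c \<in> Ob A\<rbrakk> \<Longrightarrow> Nul A b c \<cdot> f = Nul A a c"
  using group_hom.hom_one[OF Comp_right_group_hom] by fastforce

text \<open>If \<open>u \<cdot> c = v \<cdot> c\<close>, then \<open>u\<close> and \<open>v\<close>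
  are two factorisations through \<open>c\<close> of the same arrow, which kills \<open>f\<close>;
  the universal property makes them equal.\<close>

lemma cokernel_epi:
  assumes "is_cokernel A c f"
  shows "is_epi A c"
proof -
  note c = cokernel_arr[OF assms]
  have "u = v" if uv: "x \<in> Ob A" "u \<in> hom_set A (Tgt A c) x" "v \<in> hom_set A (Tgt A c) x" "u \<cdot> c = v \<cdot> c" for x u v
  proof -
    have "(u \<cdot> c) \<cdot> f = Nul A (Src A f) x"
      using Comp_assoc[OF c(2,1) uv(2)] c(3) Comp_Nul[OF uv(2)] hom_Ob[OF c(2)] by simp
    moreover have "u \<cdot> c \<in> hom_set A (Tgt A f) x"
      using Comp_in_hom[OF c(1) uv(2)] .
    ultimately have "\<exists>!w. w \<in> hom_set A (Tgt A c) x \<and> w \<cdot> c = u \<cdot> c"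
      using assms uv(1) by (auto simp: is_cokernel_def)
    then show ?thesis using uv by metis
  qed
  then show ?thesis using c by (auto simp: is_epi_def inj_on_def hom_set_iff)
qed

lemma kernel_mono:
  assumes "is_kernel A k f"
  shows "is_mono A k"
proof -
  note k = kernel_arr[OF assms]
  have "u = v" if uv: "u \<in> hom_set A x (Src A k)" "v \<in> hom_set A x (Src A k)" "k \<cdot> u = k \<cdot> v" for x u v
  proof -
    have "f \<cdot> (k \<cdot> u) = Nul A x (Tgt A f)"
      using Comp_assoc[OF uv(1) k(1,2)] k(3) Nul_Comp[OF uv(1)] hom_Ob[OF k(2)] by simp
    moreover have "k \<cdot> u \<in> hom_set A x (Src A f)"
      using Comp_in_hom[OF uv(1) k(1)] .
    ultimately have "\<exists>!w. w \<in> hom_set A x (Src A k) \<and> k \<cdot> w = k \<cdot> u"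
      using assms hom_Ob[OF uv(1)] by (auto simp: is_kernel_def)
    then show ?thesis using uv by metis
  qed
  then show ?thesis by (rule monoI[OF k(1)])
qed

text \<open>Composition with \<open>m\<close> is a homomorphism of hom groups, so on each of them
  injectivity amounts to a trivial kernel.\<close>

lemma mono_iff:
  assumes m: "m \<in> hom_set A a b"
  shows "is_mono A m \<longleftrightarrow> (\<forall>x. \<forall>u \<in> hom_set A x a. m \<cdot> u = Nul A x b \<longrightarrow> u = Nul A x a)"
proof -
  have "inj_on (Comp A m) (hom_set A x a) \<longleftrightarrow> (\<forall>u \<in> hom_set A x a. m \<cdot> u = Nul A x b \<longrightarrow> u = Nul A x a)"
    if "x \<in> Ob A" for x
    using group_hom.inj_iff_trivial_ker[OF Comp_group_hom[OF m that]] Comp_Nul[OF m that]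
      Nul_in_hom[OF that] hom_Ob[OF m] by (auto simp: kernel_def)
  then show ?thesis using m hom_Ob unfolding is_mono_def by (auto simp: hom_set_iff)
qed

lemma epi_iff:
  assumes e: "e \<in> hom_set A a b"
  shows "is_epi A e \<longleftrightarrow> (\<forall>x. \<forall>u \<in> hom_set A b x. u \<cdot> e = Nul A a x \<longrightarrow> u = Nul A b x)"
proof -
  have "inj_on (\<lambda>g. g \<cdot> e) (hom_set A b x) \<longleftrightarrow> (\<forall>u \<in> hom_set A b x. u \<cdot> e = Nul A a x \<longrightarrow> u = Nul A b x)"
    if "x \<in> Ob A" for x
    using group_hom.inj_iff_trivial_ker[OF Comp_right_group_hom[OF e that]] Nul_Comp[OF e that]
      Nul_in_hom[OF _ that] hom_Ob[OF e] by (auto simp: kernel_def)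
  then show ?thesis using e hom_Ob unfolding is_epi_def by (auto simp: hom_set_iff)
qed

text \<open>A monic \<open>m\<close> cancels, so \<open>m \<cdot> f\<close> and \<open>f\<close>
  kill the same arrows. In a resolution this identifies the kernel of a differential with that of
  the precover it is built from.\<close>

lemma kernel_comp_mono:
  assumes "is_kernel A k f" "is_mono A m" "m \<in> hom_set A (Tgt A f) c"
  shows "is_kernel A k (m \<cdot> f)"
proof -
  note k = kernel_arr[OF assms(1)] and c = hom_Ob[OF assms(3)]
  show ?thesis
  proof (rule kernelI[OF kernel_mono[OF assms(1)] k(1) Comp_in_hom[OF k(2) assms(3)]])
    show "(m \<cdot> f) \<cdot> k = Nul A (Src A k) c"
      using Comp_assoc[OF k(1,2) assms(3)] k(3) Comp_Nul[OF assms(3)] hom_Ob[OF k(1)] by simp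
  next
    fix x h assume h: "h \<in> hom_set A x (Src A f)" "(m \<cdot> f) \<cdot> h = Nul A x c"
    then have "m \<cdot> (f \<cdot> h) = Nul A x c" using Comp_assoc[OF h(1) k(2) assms(3)] by simp
    then have "f \<cdot> h = Nul A x (Tgt A f)"
      using mono_iff[OF assms(3)] assms(2) Comp_in_hom[OF h(1) k(2)] by blast
    then show "\<exists>u\<in>hom_set A x (Src A k). k \<cdot> u = h"
      using kernel_factor[OF assms(1) k(2) h(1)] by blast
  qed
qed

text \<open>Dually to the above, an epimorphism in front cancels. In
  \<open>exact_at_comp_epi\<close> this shows that the image of a monic arrow after an epimorphism
  is the monic arrow itself.\<close>

lemma cokernel_comp_epi:
  assumes "is_cokernel A c f" "is_epi A e" "e \<in> hom_set A d (Src A f)"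
  shows "is_cokernel A c (f \<cdot> e)"
proof -
  note c = cokernel_arr[OF assms(1)] and d = hom_Ob[OF assms(3)]
  show ?thesis
  proof (rule cokernelI[OF cokernel_epi[OF assms(1)] c(1) Comp_in_hom[OF assms(3) c(2)]])
    show "c \<cdot> (f \<cdot> e) = Nul A d (Tgt A c)"
      using Comp_assoc[OF assms(3) c(2,1)] c(3) Nul_Comp[OF assms(3)] hom_Ob[OF c(1)] by simp
  next
    fix x h assume h: "h \<in> hom_set A (Tgt A f) x" "h \<cdot> (f \<cdot> e) = Nul A d x"
    then have "(h \<cdot> f) \<cdot> e = Nul A d x" using Comp_assoc[OF assms(3) c(2) h(1)] by simp
    then have "h \<cdot> f = Nul A (Src A f) x"
      using epi_iff[OF assms(3)] assms(2) Comp_in_hom[OF c(2) h(1)] by blast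
    then show "\<exists>u\<in>hom_set A (Tgt A c) x. u \<cdot> c = h"
      using cokernel_factor[OF assms(1) c(2) h(1)] by blast
  qed
qed

text \<open>Two kernels of \<open>c\<close> factor through each other, here by \<open>u\<close> and
  \<open>v\<close>, so factorisations through one turn into factorisations through the other.
  Exactness provides only some image \<open>m\<close> of an arrow; this lets a different choice take
  its place.\<close>

lemma kernel_transfer:
  assumes "is_kernel A m c" "is_kernel A k c" "is_kernel A m g"
  shows "is_kernel A k g"
proof -
  note mc = kernel_arr[OF assms(1)] and kc = kernel_arr[OF assms(2)] and mg = kernel_arr[OF assms(3)]
  have SS: "Src A c = Src A g" using mc mg by (simp add: hom_set_iff)
  have kg: "k \<in> hom_set A (Src A k) (Src A g)" using kc SS by simp
  obtain u where u: "u \<in> hom_set A (Src A m) (Src A k)" "k \<cdot> u = m"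
    using kernel_factor[OF assms(2) kc(2) mc(1,3)] .
  obtain v where v: "v \<in> hom_set A (Src A k) (Src A m)" "m \<cdot> v = k"
    using kernel_factor[OF assms(1) mc(2) kc(1,3)] .
  show ?thesis
  proof (rule kernelI[OF kernel_mono[OF assms(2)] kg mg(2)])
    show "g \<cdot> k = Nul A (Src A k) (Tgt A g)"
      using Comp_assoc[OF v(1) mg(1,2)] mg(3) Nul_Comp[OF v(1)] hom_Ob[OF mg(2)] v(2) by simp
  next
    fix x h assume h: "h \<in> hom_set A x (Src A g)" "g \<cdot> h = Nul A x (Tgt A g)"
    obtain w where w: "w \<in> hom_set A x (Src A m)" "m \<cdot> w = h"
      using kernel_factor[OF assms(3) mg(2) h] .
    then have "k \<cdot> (u \<cdot> w) = h" using Comp_assoc[OF w(1) u(1) kg] u(2) by simp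
    then show "\<exists>u\<in>hom_set A x (Src A k). k \<cdot> u = h" using Comp_in_hom[OF w(1) u(1)] by blast
  qed
qed

end

section \<open>Short exact sequences in abelian categories\<close>

context abelian_category
begin

text \<open>The axiom makes \<open>m\<close> a kernel of some \<open>f\<close>. As \<open>f\<close>
  kills \<open>m\<close>, it factors through \<open>c\<close>; hence whatever \<open>c\<close> kills
  is killed by \<open>f\<close> and factors through \<open>m\<close>.\<close>

lemma mono_kernel_of_cokernel:
  assumes "is_mono A m" "is_cokernel A c m"
  shows "is_kernel A m c"
proof -
  note c = cokernel_arr[OF assms(2)]
  obtain f where f: "is_kernel A m f" using mono_is_kernel[OF assms(1)] ..
  note m = kernel_arr[OF f]
  have fm: "f \<in> hom_set A (Tgt A m) (Tgt A f)" using m by (simp add: hom_set_iff)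
  obtain w where w: "w \<in> hom_set A (Tgt A c) (Tgt A f)" "w \<cdot> c = f"
    using cokernel_factor[OF assms(2) c(2) fm m(3)] .
  show ?thesis
  proof (rule kernelI[OF assms(1) c(2,1,3)])
    fix x h assume h: "h \<in> hom_set A x (Tgt A m)" "c \<cdot> h = Nul A x (Tgt A c)"
    have "f \<cdot> h = Nul A x (Tgt A f)"
      using Comp_assoc[OF h(1) c(1) w(1)] w(2) h(2) Comp_Nul[OF w(1)] hom_Ob[OF h(1)] by simp
    then show "\<exists>u\<in>hom_set A x (Src A m). m \<cdot> u = h"
      using kernel_factor[OF f fm h(1)] by blast
  qed
qed

lemma epi_cokernel_of_kernel:
  assumes "is_epi A e" "is_kernel A k e"
  shows "is_cokernel A e k"
proof -
  note k = kernel_arr[OF assms(2)]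
  obtain f where f: "is_cokernel A e f" using epi_is_cokernel[OF assms(1)] ..
  note e = cokernel_arr[OF f]
  have fe: "f \<in> hom_set A (Src A f) (Src A e)" using e by (simp add: hom_set_iff)
  obtain w where w: "w \<in> hom_set A (Src A f) (Src A k)" "k \<cdot> w = f"
    using kernel_factor[OF assms(2) k(2) fe e(3)] .
  show ?thesis
  proof (rule cokernelI[OF assms(1) k(2,1,3)])
    fix x h assume h: "h \<in> hom_set A (Src A e) x" "h \<cdot> k = Nul A (Src A k) x"
    have "h \<cdot> f = Nul A (Src A f) x"
      using Comp_assoc[OF w(1) k(1) h(1)] w(2) h(2) Nul_Comp[OF w(1)] hom_Ob[OF h(1)] by simp
    then show "\<exists>u\<in>hom_set A (Tgt A e) x. u \<cdot> e = h"
      using cokernel_factor[OF f fe h(1)] by blast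
  qed
qed

lemma kernel_of_Nul:
  assumes "a \<in> Ob A" "z \<in> Ob A"
  shows "is_kernel A (Idn A a) (Nul A a z)"
  by (rule kernelI[OF Idn_mono[OF assms(1)] Idn_in_hom[OF assms(1)] Nul_in_hom[OF assms]])
    (use assms in \<open>auto intro: Idn_Comp Nul_Comp Idn_in_hom\<close>)

lemma zero_object_hom:
  assumes "zero_object A z"
  shows "u \<in> hom_set A x z \<Longrightarrow> u = Nul A x z" "v \<in> hom_set A z x \<Longrightarrow> v = Nul A z x"
  using assms hom_Ob Nul_in_hom unfolding zero_object_def by metis+

lemma kernel_of_mono:
  assumes "is_mono A m" "m \<in> hom_set A a b" "zero_object A z"
  shows "is_kernel A (Nul A z a) m"
proof -
  have ob: "z \<in> Ob A" "a \<in> Ob A" "b \<in> Ob A" using assms hom_Ob by (auto simp: zero_object_def)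
  show ?thesis
  proof (rule kernelI[OF _ Nul_in_hom[OF ob(1,2)] assms(2) Comp_Nul[OF assms(2) ob(1)]])
    show "is_mono A (Nul A z a)"
      by (rule monoI[OF Nul_in_hom[OF ob(1,2)]]) (metis zero_object_hom(1)[OF assms(3)])
  next
    fix x h assume h: "h \<in> hom_set A x a" "m \<cdot> h = Nul A x b"
    then have "h = Nul A x a" using assms(1) mono_iff[OF assms(2)] by blast
    then show "\<exists>u\<in>hom_set A x z. Nul A z a \<cdot> u = h"
      using hom_Ob[OF h(1)] ob by (metis Nul_Comp Nul_in_hom)
  qed
qed

lemma cokernel_of_epi:
  assumes "is_epi A e" "e \<in> hom_set A a b" "zero_object A z"
  shows "is_cokernel A (Nul A b z) e"
proof -
  have ob: "z \<in> Ob A" "a \<in> Ob A" "b \<in> Ob A" using assms hom_Ob by (auto simp: zero_object_def)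
  show ?thesis
  proof (rule cokernelI[OF _ Nul_in_hom[OF ob(3,1)] assms(2) Nul_Comp[OF assms(2) ob(1)]])
    show "is_epi A (Nul A b z)"
      unfolding epi_iff[OF Nul_in_hom[OF ob(3,1)]] using zero_object_hom(2)[OF assms(3)] by blast
  next
    fix x h assume h: "h \<in> hom_set A b x" "h \<cdot> e = Nul A a x"
    then have "h = Nul A b x" using assms(1) epi_iff[OF assms(2)] by blast
    then show "\<exists>u\<in>hom_set A z x. u \<cdot> Nul A b z = h"
      using hom_Ob[OF h(1)] ob by (metis Nul_Comp Nul_in_hom)
  qed
qed

text \<open>The cokernel of \<open>k\<close> is also one of \<open>k \<cdot> p\<close>, and the
  monic \<open>k\<close> is its kernel; so \<open>k\<close> is the image of
  \<open>k \<cdot> p\<close>. Differentials of a resolution have this shape.\<close>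

lemma exact_at_comp_epi:
  assumes "is_kernel A k g" "is_epi A p" "p \<in> hom_set A a (Src A k)"
  shows "exact_at A (k \<cdot> p) g"
proof -
  obtain c where c: "is_cokernel A c k"
    using ex_cokernel kernel_arr[OF assms(1)] by (auto simp: hom_set_iff)
  have "is_image A k (k \<cdot> p)"
    unfolding is_image_def
    using cokernel_comp_epi[OF c assms(2,3)] mono_kernel_of_cokernel[OF kernel_mono[OF assms(1)] c] by blast
  then show ?thesis using assms(1) by (auto simp: exact_at_def)
qed

lemma exact_at_kernel:
  assumes "is_kernel A k g"
  shows "exact_at A k g"
proof -
  have s: "Src A k \<in> Ob A" using kernel_arr[OF assms] hom_Ob by blast
  show ?thesis
    using exact_at_comp_epi[OF assms Idn_epi[OF s] Idn_in_hom[OF s]] Comp_Idn[OF kernel_arr(1)[OF assms]] by simp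
qed

lemma exact_at_epi:
  assumes "is_epi A e" "e \<in> hom_set A a b" "zero_object A z"
  shows "exact_at A e (Nul A b z)"
proof -
  have ob: "b \<in> Ob A" "z \<in> Ob A" using hom_Ob[OF assms(2)] assms(3) by (auto simp: zero_object_def)
  show ?thesis unfolding exact_at_def is_image_def
    using cokernel_of_epi[OF assms] kernel_of_Nul[OF ob] by blast
qed

lemma exact_at_Nul_imp_mono:
  assumes "exact_at A (Nul A z a) f" "z \<in> Ob A" "f \<in> hom_set A a b"
  shows "is_mono A f"
proof -
  obtain m c where mc: "is_cokernel A c (Nul A z a)" "is_kernel A m c" "is_kernel A m f"
    using assms(1) by (auto simp: exact_at_def is_image_def)
  have a: "a \<in> Ob A" using hom_Ob[OF assms(3)] by simp
  note m = kernel_arr[OF mc(2)] and mf = kernel_arr[OF mc(3)]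
  have ca: "c \<in> hom_set A a (Tgt A c)"
    using cokernel_arr(1)[OF mc(1)] Nul_in_hom[OF assms(2) a] by (simp add: hom_set_iff)
  have ma: "m \<in> hom_set A (Src A m) a" using m(1) ca by (simp add: hom_set_iff)
  \<comment> \<open>The identity composed with the zero arrow is zero, so it factors through the
    cokernel \<open>c\<close>. Thus \<open>c\<close> has a left inverse, and
    \<open>c \<cdot> m = 0\<close> forces \<open>m = 0\<close>.\<close>
  obtain u where u: "u \<in> hom_set A (Tgt A c) a" "u \<cdot> c = Idn A a"
    using cokernel_factor[OF mc(1) Nul_in_hom[OF assms(2) a] Idn_in_hom[OF a]]
      Idn_Comp[OF Nul_in_hom[OF assms(2) a]] by blast
  have m0: "m = Nul A (Src A m) a"
    using Comp_assoc[OF ma ca u(1)] u Idn_Comp[OF ma] m(3) Comp_Nul[OF u(1)] hom_Ob[OF m(1)] by simp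
  show ?thesis unfolding mono_iff[OF assms(3)]
  proof (intro allI ballI impI)
    fix x h assume h: "h \<in> hom_set A x a" "f \<cdot> h = Nul A x b"
    obtain v where "v \<in> hom_set A x (Src A m)" "m \<cdot> v = h"
      using kernel_factor[OF mc(3) assms(3) h] .
    then show "h = Nul A x a" using m0 Nul_Comp a by metis
  qed
qed

lemma exact_at_Nul_imp_epi:
  assumes "exact_at A g (Nul A b z)" "z \<in> Ob A" "g \<in> hom_set A a b"
  shows "is_epi A g"
proof -
  obtain m c where mc: "is_cokernel A c g" "is_kernel A m c" "is_kernel A m (Nul A b z)"
    using assms(1) by (auto simp: exact_at_def is_image_def)
  have b: "b \<in> Ob A" using hom_Ob[OF assms(3)] by simp
  note m = kernel_arr[OF mc(2)] and mf = kernel_arr[OF mc(3)]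
  have cb: "c \<in> hom_set A b (Tgt A c)"
    using cokernel_arr(1)[OF mc(1)] assms(3) by (simp add: hom_set_iff)
  have mb: "m \<in> hom_set A (Src A m) b" using m(1) cb by (simp add: hom_set_iff)
  \<comment> \<open>Dually, the identity factors through the kernel \<open>m\<close> of a zero
    arrow. Thus \<open>m\<close> has a right inverse, and \<open>c \<cdot> m = 0\<close> forces
    \<open>c = 0\<close>.\<close>
  obtain v where v: "v \<in> hom_set A b (Src A m)" "m \<cdot> v = Idn A b"
    using kernel_factor[OF mc(3) Nul_in_hom[OF b assms(2)] Idn_in_hom[OF b]]
      Comp_Idn[OF Nul_in_hom[OF b assms(2)]] by blast
  have c0: "c = Nul A b (Tgt A c)"
    using Comp_assoc[OF v(1) mb cb] v Comp_Idn[OF cb] m(3) Nul_Comp[OF v(1)] hom_Ob[OF cb] by simp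
  show ?thesis unfolding epi_iff[OF assms(3)]
  proof (intro allI ballI impI)
    fix x h assume h: "h \<in> hom_set A b x" "h \<cdot> g = Nul A a x"
    obtain w where "w \<in> hom_set A (Tgt A c) x" "w \<cdot> c = h"
      using cokernel_factor[OF mc(1) assms(3) h] .
    then show "h = Nul A b x" using c0 Comp_Nul b by metis
  qed
qed

text \<open>Exactness in the middle says only that some image of \<open>f\<close> is a kernel of
  \<open>g\<close>. Exactness on the left makes \<open>f\<close> monic, hence its own image, so
  \<open>f\<close> itself is a kernel of \<open>g\<close>.\<close>

lemma short_exact_iff: "short_exact A f g \<longleftrightarrow> is_kernel A f g \<and> is_epi A g"
proof
  assume "short_exact A f g"
  then obtain z where z: "zero_object A z" "exact_at A (Nul A z (Src A f)) f" "exact_at A f g"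
      "exact_at A g (Nul A (Tgt A g) z)"
    by (auto simp: short_exact_def)
  have zO: "z \<in> Ob A" using z(1) by (simp add: zero_object_def)
  obtain m c where m: "is_cokernel A c f" "is_kernel A m c" "is_kernel A m g"
    using z(3) by (auto simp: exact_at_def is_image_def)
  have f: "f \<in> hom_set A (Src A f) (Tgt A f)" using cokernel_arr[OF m(1)] by simp
  have "is_kernel A f c"
    using mono_kernel_of_cokernel[OF exact_at_Nul_imp_mono[OF z(2) zO f] m(1)] .
  then have "is_kernel A f g" using kernel_transfer m by blast
  moreover have "is_epi A g" using exact_at_Nul_imp_epi[OF z(4) zO] kernel_arr(2)[OF m(3)] by blast
  ultimately show "is_kernel A f g \<and> is_epi A g" ..
next
  assume r: "is_kernel A f g \<and> is_epi A g"
  then have f: "f \<in> hom_set A (Src A f) (Src A g)" and g: "g \<in> hom_set A (Src A g) (Tgt A g)"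
    using kernel_arr by blast+
  obtain z where z: "zero_object A z" using ex_zero_object ..
  then have ob: "z \<in> Ob A" "Src A f \<in> Ob A" using hom_Ob[OF f] by (auto simp: zero_object_def)
  have "exact_at A (Nul A z (Src A f)) f"
    using exact_at_kernel[OF kernel_of_mono[OF kernel_mono f z]] r by blast
  then show "short_exact A f g"
    unfolding short_exact_def using z r exact_at_epi[OF _ g z] exact_at_kernel by blast
qed

end

text \<open>Only the lifting property is recorded. It is shared by special precovers, augmentations
  of proper resolutions and identities of objects in \<open>W\<close>, and it already determines the
  image under an additive functor.\<close>

definition precover :: "('o, 'm) ab_cat \<Rightarrow> 'o set \<Rightarrow> 'm \<Rightarrow> bool" where
  "precover A W p \<longleftrightarrow> p \<in> Arr A \<and> Src A p \<in> W \<and>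
    (\<forall>X\<in>W. \<forall>h\<in>hom_set A X (Tgt A p). \<exists>u\<in>hom_set A X (Src A p). p \<cdot>\<^bsub>A\<^esub> u = h)"

section \<open>Pullbacks of short exact sequences and lifting through special precovers\<close>

context abelian_category
begin

text \<open>Base change along \<open>h\<close> turns a sequence ending in \<open>Tgt A g\<close>
  into an extension of \<open>x\<close> with the same left-hand object, to which vanishing of Ext
  can be applied.\<close>

lemma pullback_short_exact:
  assumes sx: "short_exact A k g" and h: "h \<in> hom_set A x (Tgt A g)"
  obtains \<iota> P R where "short_exact A \<iota> P" "Src A \<iota> = Src A k" "P \<in> hom_set A (Src A P) x"
    "R \<in> hom_set A (Src A P) (Src A g)" "g \<cdot> R = h \<cdot> P"
proof -
  define a b c where "a = Src A g" and "b = Tgt A g" and "c = Src A k"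
  have ker: "is_kernel A k g" and epi: "is_epi A g" using sx by (auto simp: short_exact_iff)
  have k: "k \<in> hom_set A c a" and g: "g \<in> hom_set A a b" and gk: "g \<cdot> k = Nul A c b"
    using kernel_arr[OF ker] by (auto simp: a_def b_def c_def)
  have h: "h \<in> hom_set A x b" using assms(2) by (simp add: b_def)
  have ob: "a \<in> Ob A" "b \<in> Ob A" "c \<in> Ob A" "x \<in> Ob A" using hom_Ob k g h by blast+
  obtain s i j p q where i: "i \<in> hom_set A a s" and j: "j \<in> hom_set A x s"
    and p: "p \<in> hom_set A s a" and q: "q \<in> hom_set A s x"
    and pi: "p \<cdot> i = Idn A a" and qj: "q \<cdot> j = Idn A x" and qi: "q \<cdot> i = Nul A a x"
    and ijpq: "(i \<cdot> p) \<boxplus> (j \<cdot> q) = Idn A s"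
    using ex_biproduct[OF ob(1,4)] unfolding biproduct_def by blast
  interpret xb: group "hom_grp A x b" using hom_grp_group ob by simp
  \<comment> \<open>The pullback is the kernel of the difference \<open>g \<circ> p - h \<circ> q\<close> out of the biproduct.\<close>
  define h' where "h' = inv\<^bsub>hom_grp A x b\<^esub> h"
  have h': "h' \<in> hom_set A x b" "h \<boxplus> h' = Nul A x b" using h xb.r_inv by (auto simp: h'_def)
  note gp = Comp_in_hom[OF p g] and h'q = Comp_in_hom[OF q h'(1)]
  define d where "d = (g \<cdot> p) \<boxplus> (h' \<cdot> q)"
  have d: "d \<in> hom_set A s b" unfolding d_def by (rule Plus_in_hom[OF gp h'q])
  \<comment> \<open>On the summand \<open>a\<close> the difference \<open>d\<close> restricts to
    \<open>g\<close>, so it inherits from \<open>g\<close> the property of being epi.\<close>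
  have di: "d \<cdot> i = g"
  proof -
    have "d \<cdot> i = (g \<cdot> p) \<cdot> i \<boxplus> (h' \<cdot> q) \<cdot> i" unfolding d_def by (rule Plus_Comp[OF i gp h'q])
    also have "\<dots> = g \<boxplus> Nul A a b"
      using Comp_assoc[OF i p g] Comp_assoc[OF i q h'(1)] pi qi Comp_Idn[OF g] Comp_Nul[OF h'(1) ob(1)] by simp
    also have "\<dots> = g"
      using monoid.r_one[OF group.is_monoid[OF hom_grp_group[OF ob(1,2)]]] g by simp
    finally show ?thesis .
  qed
  have d_epi: "is_epi A d" unfolding epi_iff[OF d]
  proof (intro allI ballI impI)
    fix y u assume u: "u \<in> hom_set A b y" "u \<cdot> d = Nul A s y"
    then have "u \<cdot> g = Nul A a y" using Comp_assoc[OF i d u(1)] di Nul_Comp[OF i] hom_Ob[OF u(1)] by simp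
    then show "u = Nul A b y" using epi epi_iff[OF g] u(1) by blast
  qed
  obtain e where e: "is_kernel A e d" using ex_kernel d by (auto simp: hom_set_iff)
  define E where "E = Src A e"
  have eh: "e \<in> hom_set A E s" and de: "d \<cdot> e = Nul A E b"
    using kernel_arr[OF e] d by (auto simp: E_def hom_set_iff)
  have EO: "E \<in> Ob A" using hom_Ob[OF eh] by simp
  note e_mono = kernel_mono[OF e]
  define P where "P = q \<cdot> e"
  define R where "R = p \<cdot> e"
  have P: "P \<in> hom_set A E x" and R: "R \<in> hom_set A E a"
    unfolding P_def R_def using Comp_in_hom eh p q by blast+
  \<comment> \<open>Both composites are additive inverses of \<open>h' \<cdot> P\<close>, hence
    equal by cancellation.\<close>
  have gR: "g \<cdot> R = h \<cdot> P"
  proof -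
    interpret Eb: group "hom_grp A E b" using hom_grp_group EO ob by simp
    have "(g \<cdot> R) \<boxplus> (h' \<cdot> P) = Nul A E b"
      using Plus_Comp[OF eh gp h'q] Comp_assoc[OF eh p g] Comp_assoc[OF eh q h'(1)] de
      by (simp add: d_def P_def R_def)
    moreover have "(h \<cdot> P) \<boxplus> (h' \<cdot> P) = Nul A E b"
      using Plus_Comp[OF P h h'(1)] h'(2) Nul_Comp[OF P ob(2)] by simp
    ultimately show ?thesis
      using Eb.right_cancel[OF Comp_in_hom[OF P h'(1)] Comp_in_hom[OF R g] Comp_in_hom[OF P h]] by simp
  qed
  have P_epi: "is_epi A P" unfolding epi_iff[OF P]
  proof (intro allI ballI impI)
    fix y u assume u: "u \<in> hom_set A x y" "u \<cdot> P = Nul A E y"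
    have y: "y \<in> Ob A" using hom_Ob[OF u(1)] by simp
    have uq: "u \<cdot> q \<in> hom_set A s y" by (rule Comp_in_hom[OF q u(1)])
    have "(u \<cdot> q) \<cdot> e = Nul A E y" using Comp_assoc[OF eh q u(1)] u(2) by (simp add: P_def)
    \<comment> \<open>As \<open>d\<close> is epi, it is a cokernel of its kernel \<open>e\<close>,
      so \<open>u \<cdot> q\<close> factors as \<open>v \<cdot> d\<close>. Restriction to the
      summand \<open>a\<close> gives \<open>v \<cdot> g = 0\<close>, so \<open>v = 0\<close>; then
      \<open>u \<cdot> q = 0\<close>, and restriction to the summand \<open>x\<close> gives
      \<open>u = 0\<close>.\<close>
    then obtain v where v: "v \<in> hom_set A b y" "v \<cdot> d = u \<cdot> q"
      using cokernel_factor[OF epi_cokernel_of_kernel[OF d_epi e] eh uq] d by (auto simp: hom_set_iff)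
    have "v \<cdot> g = (u \<cdot> q) \<cdot> i" using Comp_assoc[OF i d v(1)] di v(2) by simp
    also have "\<dots> = Nul A a y" using Comp_assoc[OF i q u(1)] qi Comp_Nul[OF u(1) ob(1)] by simp
    finally have "v = Nul A b y" using epi epi_iff[OF g] v(1) by blast
    then have "u \<cdot> q = Nul A s y" using v(2) Nul_Comp[OF d y] by simp
    then show "u = Nul A x y"
      using Comp_assoc[OF j q u(1)] qj Comp_Idn[OF u(1)] Nul_Comp[OF j y] by simp
  qed
  have ik: "i \<cdot> k \<in> hom_set A c s" by (rule Comp_in_hom[OF k i])
  \<comment> \<open>The kernel of the pulled back arrow is \<open>k\<close> placed in the summand
    \<open>a\<close>: there \<open>d\<close> is \<open>g\<close>, so \<open>i \<cdot> k\<close>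
    lands in the kernel \<open>e\<close>.\<close>
  have "d \<cdot> (i \<cdot> k) = Nul A c b" using Comp_assoc[OF k i d] di gk by simp
  then obtain \<iota> where \<iota>: "\<iota> \<in> hom_set A c E" "e \<cdot> \<iota> = i \<cdot> k"
    using kernel_factor[OF e d ik] E_def by metis
  have "is_kernel A \<iota> P"
  proof (rule kernelI[OF _ \<iota>(1) P])
    show "is_mono A \<iota>"
    proof (rule monoI[OF \<iota>(1)])
      fix y u v assume u: "u \<in> hom_set A y c" and v: "v \<in> hom_set A y c" and "\<iota> \<cdot> u = \<iota> \<cdot> v"
      then have "(i \<cdot> k) \<cdot> u = (i \<cdot> k) \<cdot> v"
        using Comp_assoc[OF u \<iota>(1) eh] Comp_assoc[OF v \<iota>(1) eh] \<iota>(2) by simp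
      moreover have "p \<cdot> ((i \<cdot> k) \<cdot> w) = k \<cdot> w" if w: "w \<in> hom_set A y c" for w
        using Comp_assoc[OF w ik p] Comp_assoc[OF k i p] pi Idn_Comp[OF k] by simp
      ultimately have "k \<cdot> u = k \<cdot> v" using u v by metis
      then show "u = v" using monoD[OF kernel_mono[OF ker] k u v] by simp
    qed
    show "P \<cdot> \<iota> = Nul A c x"
      using Comp_assoc[OF \<iota>(1) eh q] \<iota>(2) Comp_assoc[OF k i q] qi Nul_Comp[OF k ob(4)] by (simp add: P_def)
  next
    fix y w assume w: "w \<in> hom_set A y E" "P \<cdot> w = Nul A y x"
    have y: "y \<in> Ob A" using hom_Ob[OF w(1)] by simp
    have Rw: "R \<cdot> w \<in> hom_set A y a" by (rule Comp_in_hom[OF w(1) R])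
    have "g \<cdot> (R \<cdot> w) = Nul A y b"
      using Comp_assoc[OF w(1) R g] Comp_assoc[OF w(1) P h] gR w(2) Comp_Nul[OF h y] by simp
    then obtain u where u: "u \<in> hom_set A y c" "k \<cdot> u = R \<cdot> w"
      using kernel_factor[OF ker g Rw] c_def by metis
    have ew: "e \<cdot> w \<in> hom_set A y s" by (rule Comp_in_hom[OF w(1) eh])
    \<comment> \<open>The arrow \<open>e \<cdot> w\<close> is split into its two components. The one
      in \<open>x\<close> is \<open>P \<cdot> w = 0\<close>, the one in \<open>a\<close> is
      \<open>R \<cdot> w = k \<cdot> u\<close>; so \<open>e \<cdot> w\<close> comes from
      \<open>u\<close> and \<open>e\<close> can be cancelled.\<close>
    have "e \<cdot> w = ((i \<cdot> p) \<boxplus> (j \<cdot> q)) \<cdot> (e \<cdot> w)" using ijpq Idn_Comp[OF ew] by simp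
    also have "\<dots> = (i \<cdot> p) \<cdot> (e \<cdot> w) \<boxplus> (j \<cdot> q) \<cdot> (e \<cdot> w)"
      by (rule Plus_Comp[OF ew Comp_in_hom[OF p i] Comp_in_hom[OF q j]])
    also have "(i \<cdot> p) \<cdot> (e \<cdot> w) = i \<cdot> (R \<cdot> w)"
      using Comp_assoc[OF ew p i] Comp_assoc[OF w(1) eh p] by (simp add: R_def)
    also have "(j \<cdot> q) \<cdot> (e \<cdot> w) = Nul A y s"
      using Comp_assoc[OF ew q j] Comp_assoc[OF w(1) eh q] w(2) Comp_Nul[OF j y] by (simp add: P_def)
    also have "i \<cdot> (R \<cdot> w) \<boxplus> Nul A y s = i \<cdot> (R \<cdot> w)"
      using monoid.r_one[OF group.is_monoid[OF hom_grp_group[of y s]]] y hom_Ob[OF i] Comp_in_hom[OF Rw i] by simp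
    also have "\<dots> = e \<cdot> (\<iota> \<cdot> u)"
      using u(2) Comp_assoc[OF u(1) k i] Comp_assoc[OF u(1) \<iota>(1) eh] \<iota>(2) by simp
    finally have "\<iota> \<cdot> u = w"
      using monoD[OF e_mono eh Comp_in_hom[OF u(1) \<iota>(1)] w(1)] by simp
    then show "\<exists>u\<in>hom_set A y c. \<iota> \<cdot> u = w" using u(1) by blast
  qed
  then show thesis
    using that[of \<iota> P R] P_epi P R gR \<iota>(1) by (auto simp: short_exact_iff hom_set_iff a_def c_def)
qed

text \<open>The class of \<open>(i, q)\<close> is an element of the quotient, hence must be the
  class of split extensions. The identity arrow shows that \<open>(i, q)\<close> belongs to its own
  class.\<close>

lemma extension_splits:
  assumes "N \<in> right_perp A W" "X \<in> W" "short_exact A i q" "Src A i = N" "Tgt A q = X"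
  obtains s where "s \<in> hom_set A X (Src A q)" "q \<cdot> s = Idn A X"
proof -
  have iq: "(i, q) \<in> extensions A X N" using assms by (simp add: extensions_def)
  have ker: "is_kernel A i q" using assms(3) by (simp add: short_exact_iff)
  note i = kernel_arr(1)[OF ker] and q = kernel_arr(2)[OF ker]
  have t: "Tgt A i = Src A q" "Src A q \<in> Ob A" using i hom_Ob[OF i] by (auto simp: hom_set_iff)
  note I = Idn_in_hom[OF t(2)]
  have "is_iso A (Idn A (Src A q))"
    using I Comp_Idn[OF I] unfolding is_iso_def by (force simp: hom_set_iff)
  then have "((i, q), (i, q)) \<in> ext_equiv A X N"
    using iq I Idn_Comp[OF i] Comp_Idn[OF q] t by (auto simp: ext_equiv_def)
  moreover have "ext_equiv A X N `` {(i, q)} = Ext1_zero A X N"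
    using quotientI[OF iq, of "ext_equiv A X N"] assms(1,2) by (auto simp: right_perp_def Ext1_def)
  ultimately have "(i, q) \<in> Ext1_zero A X N" by blast
  then show thesis using that by (auto simp: Ext1_zero_def)
qed

text \<open>To lift \<open>h\<close>, the special precover is pulled back along it. The result is an
  extension of \<open>X\<close> by an object of \<open>right_perp A W\<close>, so it splits, and the
  section followed by \<open>R\<close> is the lift.\<close>

lemma special_precover_is_precover:
  assumes "short_exact A k p" "Src A p \<in> W" "Src A k \<in> right_perp A W"
  shows "precover A W p"
proof -
  have ker: "is_kernel A k p" using assms(1) by (simp add: short_exact_iff)
  note k = kernel_arr(1)[OF ker] and p = kernel_arr(2)[OF ker]
  have "\<exists>u\<in>hom_set A X (Src A p). p \<cdot> u = h" if X: "X \<in> W" and h: "h \<in> hom_set A X (Tgt A p)" for X h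
  proof -
    obtain \<iota> P R where *: "short_exact A \<iota> P" "Src A \<iota> = Src A k" "P \<in> hom_set A (Src A P) X"
        "R \<in> hom_set A (Src A P) (Src A p)" "p \<cdot> R = h \<cdot> P"
      using pullback_short_exact[OF assms(1) h] .
    obtain s where s: "s \<in> hom_set A X (Src A P)" "P \<cdot> s = Idn A X"
      using extension_splits[OF assms(3) X *(1,2)] *(3) by (auto simp: hom_set_iff)
    have "p \<cdot> (R \<cdot> s) = h"
      using Comp_assoc[OF s(1) *(4) p] Comp_assoc[OF s(1) *(3) h] *(5) s(2) Comp_Idn[OF h] by simp
    then show ?thesis using Comp_in_hom[OF s(1) *(4)] by blast
  qed
  then show ?thesis using assms(2) p by (auto simp: precover_def hom_set_iff)
qed

end

section \<open>Proper resolutions\<close>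

text \<open>Every element of \<open>L\<close> is killed by a map to a trivial group, so exactness at
  \<open>L\<close> is surjectivity of \<open>g\<close>.\<close>

lemma right_exact_seq_iff:
  "right_exact_seq L K H g f \<longleftrightarrow> exact_seq ([L, K, H], [g, f]) \<and> g ` carrier K = carrier L"
proof
  assume "right_exact_seq L K H g f"
  then obtain T e where T: "exact_seq ([T, L, K, H], [e, g, f])" "trivial_group T"
    by (auto simp: right_exact_seq_def)
  have "exact_seq ([L, K, H], [g, f])" using truncated_seq_is_exact_seq[OF T(1)] by simp
  moreover have "group_hom L T e"
    by (rule exact_seq_imp_group_hom[of _ _ "[K, H]" "[g, f]"]) (simp only: fst_conv snd_conv T(1))
  moreover have "g ` carrier K = kernel L T e"
    by (rule exact_seq_imp_exact_hom[of _ _ _ "[H]" "[f]"]) (simp only: fst_conv snd_conv T(1))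
  ultimately show "exact_seq ([L, K, H], [g, f]) \<and> g ` carrier K = carrier L"
    using group_hom.kernel_to_trivial_group[OF _ T(2)] by simp
next
  assume r: "exact_seq ([L, K, H], [g, f]) \<and> g ` carrier K = carrier L"
  \<comment> \<open>Any one-element group serves as the end term; \<open>undefined\<close> merely
    names an element of the type at hand.\<close>
  let ?T = "singleton_group undefined" and ?e = "\<lambda>_. undefined"
  have "?e \<in> hom L ?T" by (simp add: hom_def singleton_group_def)
  moreover have "kernel L ?T ?e = g ` carrier K" using r by (auto simp: kernel_def singleton_group_def)
  ultimately have "exact_seq ([?T, L, K, H], [?e, g, f])"
    using exact_seq.extension[OF conjunct1[OF r] singleton_group] by blast
  then show "right_exact_seq L K H g f" unfolding right_exact_seq_def by (intro exI[of _ ?T] exI[of _ ?e] conjI trivial_singleton_group)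
qed

context abelian_category
begin

text \<open>Hom is left exact, so the kernel of \<open>Comp A g\<close> consists of the arrows
  through \<open>k\<close>, and lifting through \<open>p\<close> turns these into arrows through
  \<open>k \<cdot> p\<close>. Taking \<open>p\<close> to be an identity treats a short exact
  sequence, taking it to be a precover treats a resolution.\<close>

lemma Hom_exact_seq:
  assumes ker: "is_kernel A k g" and p: "p \<in> hom_set A c (Src A k)" and X: "X \<in> Ob A"
    and lift: "\<And>h. h \<in> hom_set A X (Src A k) \<Longrightarrow> \<exists>u\<in>hom_set A X c. p \<cdot> u = h"
  shows "exact_seq ([hom_grp A X (Tgt A g), hom_grp A X (Src A g), hom_grp A X c], [Comp A g, Comp A (k \<cdot> p)])"
proof -
  note k = kernel_arr(1)[OF ker] and g = kernel_arr(2)[OF ker] and gk = kernel_arr(3)[OF ker]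
  note kp = Comp_in_hom[OF p k]
  note G = Comp_group_hom[OF g X] and KP = Comp_group_hom[OF kp X]
  have "kernel (hom_grp A X (Src A g)) (hom_grp A X (Tgt A g)) (Comp A g) = Comp A (k \<cdot> p) ` hom_set A X c"
  proof (intro equalityI subsetI)
    fix h assume "h \<in> kernel (hom_grp A X (Src A g)) (hom_grp A X (Tgt A g)) (Comp A g)"
    then have h: "h \<in> hom_set A X (Src A g)" "g \<cdot> h = Nul A X (Tgt A g)" by (auto simp: kernel_def)
    obtain w where w: "w \<in> hom_set A X (Src A k)" "k \<cdot> w = h" using kernel_factor[OF ker g h] .
    obtain u where u: "u \<in> hom_set A X c" "p \<cdot> u = w" using lift[OF w(1)] by blast
    have "h = (k \<cdot> p) \<cdot> u" using Comp_assoc[OF u(1) p k] u(2) w(2) by simp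
    then show "h \<in> Comp A (k \<cdot> p) ` hom_set A X c" using u(1) by blast
  next
    fix h assume "h \<in> Comp A (k \<cdot> p) ` hom_set A X c"
    then obtain u where u: "u \<in> hom_set A X c" "h = (k \<cdot> p) \<cdot> u" by blast
    have "g \<cdot> h = (g \<cdot> (k \<cdot> p)) \<cdot> u" using u(2) Comp_assoc[OF u(1) kp g] by simp
    also have "g \<cdot> (k \<cdot> p) = Nul A c (Tgt A g)" using Comp_assoc[OF p k g] gk Nul_Comp[OF p] hom_Ob[OF g] by simp
    also have "Nul A c (Tgt A g) \<cdot> u = Nul A X (Tgt A g)" using Nul_Comp[OF u(1)] hom_Ob[OF g] by simp
    finally show "h \<in> kernel (hom_grp A X (Src A g)) (hom_grp A X (Tgt A g)) (Comp A g)"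
      using Comp_in_hom[OF u(1) kp] u(2) by (simp add: kernel_def)
  qed
  then show ?thesis using G KP by (auto simp: group_hom_def group_hom_axioms_def)
qed

text \<open>Left exactness of Hom leaves only surjectivity at the right end, which is the lifting
  property of the precover.\<close>

lemma special_precover_Hom_short_exact:
  assumes sx: "short_exact A k p" and pre: "precover A W p" and W: "W \<subseteq> Ob A"
  shows "Hom_short_exact A W k p"
proof -
  have ker: "is_kernel A k p" using sx by (simp add: short_exact_iff)
  note k = kernel_arr(1)[OF ker] and p = kernel_arr(2)[OF ker]
  have "short_exact_sequence (hom_grp A X (Tgt A p)) (hom_grp A X (Src A p)) (hom_grp A X (Src A k)) (Comp A p) (Comp A k)"
    if XW: "X \<in> W" for X
  proof -
    have X: "X \<in> Ob A" using XW W by blast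
    have sk: "Src A k \<in> Ob A" "Tgt A k = Src A p" using hom_Ob[OF k] k by (auto simp: hom_set_iff)
    have "exact_seq ([hom_grp A X (Tgt A p), hom_grp A X (Src A p), hom_grp A X (Src A k)], [Comp A p, Comp A k])"
      using Hom_exact_seq[OF ker Idn_in_hom[OF sk(1)] X] Idn_Comp Comp_Idn[OF k] by fastforce
    moreover have "Comp A p \<in> epi (hom_grp A X (Src A p)) (hom_grp A X (Tgt A p))"
      using Comp_group_hom[OF p X] pre XW
      by (force simp: epi_iff_subset precover_def group_hom_def group_hom_axioms_def)
    moreover have "Comp A k \<in> mon (hom_grp A X (Src A k)) (hom_grp A X (Src A p))"
      using Comp_group_hom[OF k X] kernel_mono[OF ker] X sk
      by (auto simp: mon_def is_mono_def group_hom_def group_hom_axioms_def)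
    ultimately show ?thesis by (simp add: short_exact_sequence_iff)
  qed
  then show ?thesis using sx by (simp add: Hom_short_exact_def)
qed

lemma special_precovering_obtain:
  assumes "special_precovering A W" "M \<in> Ob A"
  obtains k p where "short_exact A k p" "Tgt A p = M" "precover A W p" "Hom_short_exact A W k p"
proof -
  have W: "W \<subseteq> Ob A" using assms by (simp add: special_precovering_def subcategory_def)
  obtain k p where kp: "short_exact A k p" "Tgt A p = M" "Src A p \<in> W" "Src A k \<in> right_perp A W"
    using assms unfolding special_precovering_def by blast
  show thesis
    using that kp special_precover_is_precover[OF kp(1,3,4)] special_precover_Hom_short_exact[OF kp(1) _ W] by blast
qed

text \<open>The resolution is spliced together from special precovers of \<open>N\<close>, of the
  kernel obtained, of the next kernel, and so on.\<close>

lemma ex_proper_resolution: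
  assumes sp: "special_precovering A W" and N: "N \<in> Ob A"
  shows "\<exists>\<delta>. proper_resolution A W N \<delta>"
proof -
  have W: "W \<subseteq> Ob A" using sp by (simp add: special_precovering_def subcategory_def)
  \<comment> \<open>Kernel and precover form a pair, so that one choice function delivers matching
    ones.\<close>
  have "\<forall>M\<in>Ob A. \<exists>kp. short_exact A (fst kp) (snd kp) \<and> Tgt A (snd kp) = M \<and> precover A W (snd kp)"
    by (metis special_precovering_obtain[OF sp] fst_conv snd_conv)
  then obtain kp where kp: "\<And>M. M \<in> Ob A \<Longrightarrow> short_exact A (fst (kp M)) (snd (kp M)) \<and> Tgt A (snd (kp M)) = M \<and> precover A W (snd (kp M))"
    by metis
  \<comment> \<open>The \<open>n\<close>-th syzygy: \<open>S 0\<close> is \<open>N\<close>, and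
    \<open>S (Suc n)\<close> is the kernel object of the precover \<open>p n\<close> of
    \<open>S n\<close>.\<close>
  define S where "S = rec_nat N (\<lambda>_ M. Src A (fst (kp M)))"
  define k where "k n = fst (kp (S n))" for n
  define p where "p n = snd (kp (S n))" for n
  have S0: "S 0 = N" and SSuc: "S (Suc n) = Src A (k n)" for n by (simp_all add: S_def k_def)
  have SO: "S n \<in> Ob A" for n
  proof (induction n)
    case 0 then show ?case using N S0 by simp
  next
    case (Suc n)
    then have "is_kernel A (k n) (p n)" using kp by (simp add: k_def p_def short_exact_iff)
    then show ?case using SSuc kernel_arr hom_Ob by metis
  qed
  have ker: "is_kernel A (k n) (p n)" and epi: "is_epi A (p n)" and Tp: "Tgt A (p n) = S n"
    and pre: "precover A W (p n)" for n
    using kp[OF SO[of n]] by (auto simp: k_def p_def short_exact_iff)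
  have p: "p n \<in> hom_set A (Src A (p n)) (S n)" and k: "k n \<in> hom_set A (S (Suc n)) (Src A (p n))" for n
    using kernel_arr[OF ker[of n]] by (simp_all add: SSuc Tp)
  \<comment> \<open>The augmentation sits at index 0, so the differential at \<open>Suc m\<close>
    passes through the syzygy \<open>S (Suc m)\<close>: first the precover of it, then its inclusion
    into the source of \<open>p m\<close>.\<close>
  define \<delta> where "\<delta> n = (case n of 0 \<Rightarrow> p 0 | Suc m \<Rightarrow> k m \<cdot> p (Suc m))" for n
  have \<delta>0: "\<delta> 0 = p 0" and \<delta>Suc: "\<delta> (Suc n) = k n \<cdot> p (Suc n)" for n by (simp_all add: \<delta>_def)
  have \<delta>_hom: "\<delta> n \<in> Arr A \<and> Src A (\<delta> n) = Src A (p n)" for n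
    using p Comp_in_hom[OF p k] by (cases n) (auto simp: \<delta>0 \<delta>Suc hom_set_iff)
  \<comment> \<open>For positive \<open>n\<close> the arrow \<open>\<delta> n\<close> is
    \<open>p n\<close> followed by a monic arrow, so both have kernel \<open>k n\<close>.\<close>
  have \<delta>_ker: "is_kernel A (k n) (\<delta> n)" for n
  proof (cases n)
    case 0 then show ?thesis using ker \<delta>0 by simp
  next
    case (Suc m)
    then show ?thesis using kernel_comp_mono[OF ker[of n] kernel_mono[OF ker[of m]]] k[of m] by (simp add: \<delta>Suc Tp)
  qed
  have pS: "p (Suc n) \<in> hom_set A (Src A (p (Suc n))) (Src A (k n))" for n using p[of "Suc n"] by (simp add: SSuc)
  have lift: "\<exists>u\<in>hom_set A X (Src A (p n)). p n \<cdot> u = h" if "X \<in> W" "h \<in> hom_set A X (S n)" for X n h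
    using pre[of n] that Tp[of n] by (auto simp: precover_def)
  have ex: "exact_seq
        ([hom_grp A X (Tgt A (\<delta> n)), hom_grp A X (Src A (\<delta> n)), hom_grp A X (Src A (\<delta> (Suc n)))],
         [Comp A (\<delta> n), Comp A (\<delta> (Suc n))])" if X: "X \<in> W" for X n
  proof -
    have "exact_seq
        ([hom_grp A X (Tgt A (\<delta> n)), hom_grp A X (Src A (\<delta> n)), hom_grp A X (Src A (p (Suc n)))],
         [Comp A (\<delta> n), Comp A (k n \<cdot> p (Suc n))])"
      using X W lift[OF X] by (intro Hom_exact_seq[OF \<delta>_ker pS]) (auto simp: SSuc)
    moreover have "Src A (\<delta> (Suc n)) = Src A (p (Suc n))" using \<delta>_hom by blast
    ultimately show ?thesis using \<delta>_hom[of n] by (simp only: \<delta>Suc)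
  qed
  have rx: "right_exact_seq (hom_grp A X N) (hom_grp A X (Src A (\<delta> 0))) (hom_grp A X (Src A (\<delta> 1)))
        (Comp A (\<delta> 0)) (Comp A (\<delta> 1))" if X: "X \<in> W" for X
  proof -
    have "Comp A (p 0) ` hom_set A X (Src A (p 0)) = hom_set A X (S 0)"
      using lift[OF X, of _ 0] Comp_in_hom[OF _ p] by force
    then show ?thesis using ex[OF X, of 0] Tp[of 0] by (simp add: right_exact_seq_iff \<delta>0 S0)
  qed
  obtain z where z: "zero_object A z" using ex_zero_object ..
  have "exact_at A (\<delta> 0) (Nul A N z)" using exact_at_epi[OF epi p z, of 0] by (simp add: \<delta>0 S0)
  moreover have "exact_at A (\<delta> (Suc n)) (\<delta> n)" for n
    unfolding \<delta>Suc by (rule exact_at_comp_epi[OF \<delta>_ker epi pS])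
  moreover have "Src A (\<delta> n) \<in> W" for n using pre[of n] \<delta>_hom by (simp add: precover_def)
  ultimately have "proper_resolution A W N \<delta>"
    unfolding proper_resolution_def using \<delta>_hom ex rx z Tp[of 0] by (auto simp: \<delta>0 S0)
  then show ?thesis by (rule exI[where x = \<delta>])
qed

lemma proper_resolution_resolution:
  assumes "special_precovering A W" "N \<in> Ob A"
  shows "proper_resolution A W N (resolution A W N)"
  unfolding resolution_def using someI_ex[OF ex_proper_resolution[OF assms]] .

end

section \<open>The stable functor\<close>

lemma trivial_FactGroup_iff:
  assumes "normal S K"
  shows "trivial_group (K Mod S) \<longleftrightarrow> S = carrier K"
proof -
  interpret normal S K by fact
  have "(\<lambda>x. S #>\<^bsub>K\<^esub> x) ` carrier K = {S} \<longleftrightarrow> S = carrier K"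
  proof
    assume *: "(\<lambda>x. S #>\<^bsub>K\<^esub> x) ` carrier K = {S}"
    show "S = carrier K"
      using * rcos_self[OF _ subgroup_axioms] subset by blast
  next
    assume "S = carrier K"
    then show "(\<lambda>x. S #>\<^bsub>K\<^esub> x) ` carrier K = {S}"
      using coset_join2[OF _ subgroup_axioms] one_closed by blast
  qed
  then show ?thesis
    using factorgroup_is_group by (simp add: trivial_group_def carrier_FactGroup)
qed

text \<open>Since \<open>h\<close> kills \<open>S\<close>, it is constant on each coset, and
  \<open>the_elem\<close> returns that constant.\<close>

lemma ab_coker_elim_coset:
  assumes "group_hom K L h" "subgroup S K" "S \<subseteq> kernel K L h" "x \<in> carrier K"
  shows "ab_coker_elim h (S #>\<^bsub>K\<^esub> x) = h x"
proof -
  interpret group_hom K L h by fact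
  have "h (s \<otimes>\<^bsub>K\<^esub> x) = h x" if "s \<in> S" for s
    using that assms(3,4) by (auto simp: kernel_def)
  then have "h ` (S #>\<^bsub>K\<^esub> x) \<subseteq> {h x}" by (auto simp: r_coset_def)
  moreover have "h x \<in> h ` (S #>\<^bsub>K\<^esub> x)" using G.rcos_self[OF assms(4,2)] by blast
  ultimately show ?thesis by (auto simp: ab_coker_elim_def the_elem_eq dest: subset_singletonD)
qed

section \<open>Additive functors and the values of the stable functor\<close>

locale additive_functor_special_precovering = abelian_category A
  for A :: "('o, 'm) ab_cat" (structure) and W :: "'o set" and G :: "('o, 'm, 'g) ab_functor" +
  assumes special_precovering: "special_precovering A W"
    and additive: "additive_functor A G"
begin

lemma W_subset_Ob: "W \<subseteq> Ob A"
  using special_precovering by (simp add: special_precovering_def subcategory_def)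

lemma OMap_comm_group: "a \<in> Ob A \<Longrightarrow> comm_group (OMap G a)"
  using additive by (simp add: additive_functor_def)

lemma AMap_group_hom:
  assumes "f \<in> hom_set A a b"
  shows "group_hom (OMap G a) (OMap G b) (AMap G f)"
  using assms additive hom_Ob[OF assms] comm_group.axioms(2)
  unfolding additive_functor_def group_hom_def group_hom_axioms_def by blast

lemma AMap_Comp:
  assumes "f \<in> hom_set A a b" "g \<in> hom_set A b c" "x \<in> carrier (OMap G a)"
  shows "AMap G (g \<cdot> f) x = AMap G g (AMap G f x)"
  using assms additive hom_Ob[OF assms(1)] hom_Ob[OF assms(2)] unfolding additive_functor_def by blast

lemma AMap_Idn: "\<lbrakk>a \<in> Ob A; x \<in> carrier (OMap G a)\<rbrakk> \<Longrightarrow> AMap G (Idn A a) x = x"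
  using additive by (simp add: additive_functor_def)

text \<open>The zero arrow is its own double, so by additivity the value equals its own square in a
  group.\<close>

lemma AMap_Nul:
  assumes "a \<in> Ob A" "b \<in> Ob A" "x \<in> carrier (OMap G a)"
  shows "AMap G (Nul A a b) x = \<one>\<^bsub>OMap G b\<^esub>"
proof -
  note N = Nul_in_hom[OF assms(1,2)]
  interpret group_hom "OMap G a" "OMap G b" "AMap G (Nul A a b)" by (rule AMap_group_hom[OF N])
  have "Nul A a b \<boxplus> Nul A a b = Nul A a b"
    using monoid.r_one[OF group.is_monoid[OF hom_grp_group[OF assms(1,2)]]] N by simp
  moreover have "AMap G (Nul A a b \<boxplus> Nul A a b) x = AMap G (Nul A a b) x \<otimes>\<^bsub>OMap G b\<^esub> AMap G (Nul A a b) x"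
    using additive assms N unfolding additive_functor_def by blast
  ultimately show ?thesis using H.l_cancel_one' hom_closed[OF assms(3)] by metis
qed

lemma AMap_image_subgroup:
  assumes "f \<in> hom_set A a b"
  shows "normal (AMap G f ` carrier (OMap G a)) (OMap G b)"
  using group_hom.img_is_subgroup[OF AMap_group_hom[OF assms]] OMap_comm_group hom_Ob[OF assms]
    comm_group.normal_iff_subgroup by blast

lemma AMap_image_factor:
  assumes "f \<in> hom_set A a b" "g \<in> hom_set A b c"
  shows "AMap G (g \<cdot> f) ` carrier (OMap G a) \<subseteq> AMap G g ` carrier (OMap G b)"
  using AMap_Comp[OF assms] group_hom.hom_closed[OF AMap_group_hom[OF assms(1)]] by force

text \<open>Each of two precovers of the same object factors through the other, so each image
  contains the other.\<close>

lemma precover_image_eq: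
  assumes "precover A W p" "precover A W p'" "Tgt A p = Tgt A p'"
  shows "AMap G p ` carrier (OMap G (Src A p)) = AMap G p' ` carrier (OMap G (Src A p'))"
proof -
  have "AMap G p ` carrier (OMap G (Src A p)) \<subseteq> AMap G p' ` carrier (OMap G (Src A p'))"
    if pp': "precover A W p" "precover A W p'" "Tgt A p = Tgt A p'" for p p'
  proof -
    have p: "p \<in> hom_set A (Src A p) (Tgt A p')" "p' \<in> hom_set A (Src A p') (Tgt A p')"
      using pp' by (auto simp: precover_def hom_set_iff)
    obtain u where u: "u \<in> hom_set A (Src A p) (Src A p')" "p' \<cdot> u = p"
      using pp' p unfolding precover_def by blast
    then show ?thesis using AMap_image_factor[OF u(1) p(2)] by simp
  qed
  then show ?thesis using assms by (metis subset_antisym)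
qed

lemma resolution_precover:
  assumes "N \<in> Ob A"
  shows "precover A W (resolution A W N 0)" "Tgt A (resolution A W N 0) = N"
proof -
  note r = proper_resolution_resolution[OF special_precovering assms]
  have "Comp A (resolution A W N 0) ` hom_set A X (Src A (resolution A W N 0)) = hom_set A X N" if "X \<in> W" for X
    using r that by (simp add: proper_resolution_def right_exact_seq_iff)
  moreover show "Tgt A (resolution A W N 0) = N" using r by (simp add: proper_resolution_def)
  ultimately show "precover A W (resolution A W N 0)"
    using r unfolding precover_def proper_resolution_def by (metis imageE)
qed

text \<open>Since \<open>G\<close> kills the composite of the first differential with the
  augmentation, \<open>rho\<close> sends the coset of \<open>x\<close> to the image of
  \<open>x\<close> under the augmentation; passing to cosets does not change the range.\<close>

lemma rho_image:
  assumes N: "N \<in> Ob A"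
  shows "rho A W G N ` carrier (OMap (L0 A W G) N) =
    AMap G (resolution A W N 0) ` carrier (OMap G (Src A (resolution A W N 0)))"
proof -
  note r = proper_resolution_resolution[OF special_precovering N]
  define d0 d1 where "d0 = resolution A W N 0" and "d1 = resolution A W N (Suc 0)"
  have W: "Src A d1 \<in> W" and Ob: "Src A d1 \<in> Ob A"
    using r W_subset_Ob by (auto simp: proper_resolution_def d1_def)
  have "right_exact_seq (hom_grp A (Src A d1) N) (hom_grp A (Src A d1) (Src A d0)) (hom_grp A (Src A d1) (Src A d1)) (Comp A d0) (Comp A d1)"
    using r W by (simp add: proper_resolution_def d0_def d1_def)
  then have ex: "group_hom (hom_grp A (Src A d1) (Src A d1)) (hom_grp A (Src A d1) (Src A d0)) (Comp A d1)"
      "kernel (hom_grp A (Src A d1) (Src A d0)) (hom_grp A (Src A d1) N) (Comp A d0) =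
        Comp A d1 ` hom_set A (Src A d1) (Src A d1)"
    by (auto simp: right_exact_seq_iff)
  have d0: "d0 \<in> hom_set A (Src A d0) N"
    using r by (auto simp: proper_resolution_def d0_def hom_set_iff)
  \<comment> \<open>Exactness under Hom is tested on the source of \<open>d1\<close>, which lies in
    \<open>W\<close>: the identity there is sent to \<open>d1\<close>, which is therefore in the
    kernel of \<open>Comp A d0\<close>.\<close>
  have "d1 \<in> Comp A d1 ` hom_set A (Src A d1) (Src A d1)"
    using r Idn_in_hom[OF Ob] Comp_Idn[OF arr_in_hom, of d1] by (force simp: proper_resolution_def d1_def)
  then have d1: "d1 \<in> hom_set A (Src A d1) (Src A d0)" "d0 \<cdot> d1 = Nul A (Src A d1) N"
    unfolding ex(2)[symmetric] by (auto simp: kernel_def)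
  define S where "S = AMap G d1 ` carrier (OMap G (Src A d1))"
  have S: "subgroup S (OMap G (Src A d0))"
    unfolding S_def by (rule group_hom.img_is_subgroup[OF AMap_group_hom[OF d1(1)]])
  have "S \<subseteq> kernel (OMap G (Src A d0)) (OMap G N) (AMap G d0)"
    using AMap_Comp[OF d1(1) d0] AMap_Nul[OF Ob N] d1(2)
      group_hom.hom_closed[OF AMap_group_hom[OF d1(1)]] by (auto simp: S_def kernel_def)
  then have "rho A W G N (S #>\<^bsub>OMap G (Src A d0)\<^esub> x) = AMap G d0 x" if "x \<in> carrier (OMap G (Src A d0))" for x
    using ab_coker_elim_coset[OF AMap_group_hom[OF d0] S] that by (simp add: rho_def d0_def)
  then show ?thesis
    by (simp add: L0_def Let_def ab_coker_def carrier_FactGroup image_image d0_def d1_def S_def)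
qed

lemma OMap_stable_functor:
  assumes "precover A W p" "Tgt A p = N"
  shows "OMap (stable_functor A W G) N = OMap G N Mod (AMap G p ` carrier (OMap G (Src A p)))"
proof -
  have N: "N \<in> Ob A" using assms Tgt_in_Ob by (auto simp: precover_def)
  have "OMap (stable_functor A W G) N = OMap G N Mod (rho A W G N ` carrier (OMap (L0 A W G) N))"
    by (simp add: stable_functor_def coker_functor_def ab_coker_def)
  then show ?thesis
    using rho_image[OF N] precover_image_eq[OF assms(1) resolution_precover(1)[OF N]]
      resolution_precover(2)[OF N] assms(2) by simp
qed

lemma stable_trivial_iff:
  assumes "precover A W p" "Tgt A p = N"
  shows "trivial_group (OMap (stable_functor A W G) N) \<longleftrightarrow>
    AMap G p ` carrier (OMap G (Src A p)) = carrier (OMap G N)"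
  using trivial_FactGroup_iff[OF AMap_image_subgroup[of p "Src A p" N]] assms
  unfolding OMap_stable_functor[OF assms] by (simp add: precover_def hom_set_iff)

text \<open>The identity of an object of \<open>W\<close> is a precover of it, and its image under
  \<open>G\<close> is everything.\<close>

lemma stable_trivial_on_W:
  assumes "X \<in> W"
  shows "trivial_group (OMap (stable_functor A W G) X)"
proof -
  have X: "X \<in> Ob A" using assms W_subset_Ob by blast
  note I = Idn_in_hom[OF X]
  have "precover A W (Idn A X)"
    using assms I Idn_Comp unfolding precover_def by (force simp: hom_set_iff)
  moreover have "AMap G (Idn A X) ` carrier (OMap G X) = carrier (OMap G X)"
    using AMap_Idn[OF X] by force
  ultimately show ?thesis using stable_trivial_iff[of "Idn A X" X] I by (simp add: hom_set_iff)
qed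

text \<open>Exact sequences of groups require their maps to be homomorphisms. Between trivial groups
  this reduces to sending the unit to the unit.\<close>

lemma AMap_stable_group_hom:
  assumes h: "h \<in> hom_set A a b" and triv: "zero_functor A (stable_functor A W G)"
  shows "group_hom (OMap (stable_functor A W G) a) (OMap (stable_functor A W G) b) (AMap (stable_functor A W G) h)"
proof -
  let ?S = "stable_functor A W G"
  have ob: "a \<in> Ob A" "b \<in> Ob A" using hom_Ob[OF h] by auto
  have *: "OMap ?S c = OMap G c Mod carrier (OMap G c)" "trivial_group (OMap ?S c)"
    "rho A W G c ` carrier (OMap (L0 A W G) c) = carrier (OMap G c)" if "c \<in> Ob A" for c
    using that triv stable_trivial_iff[OF resolution_precover] OMap_stable_functor[OF resolution_precover]
    by (auto simp: zero_functor_def rho_image)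
  have one: "\<one>\<^bsub>OMap ?S c\<^esub> = carrier (OMap G c)" if "c \<in> Ob A" for c
    by (simp add: *[OF that] FactGroup_def)
  interpret G: group_hom "OMap G a" "OMap G b" "AMap G h" by (rule AMap_group_hom[OF h])
  \<comment> \<open>The unit of each quotient is the full carrier as a coset. All elements of
    \<open>carrier (OMap G a)\<close> are sent to the single coset of the full carrier over
    \<open>b\<close>, which \<open>the_elem\<close> extracts.\<close>
  have "AMap ?S h (carrier (OMap G a)) =
    the_elem ((\<lambda>x. carrier (OMap G b) #>\<^bsub>OMap G b\<^esub> AMap G h x) ` carrier (OMap G a))"
    using h *(3)[OF ob(2)]
    by (simp add: stable_functor_def coker_functor_def ab_coker_map_def ab_coker_elim_def hom_set_iff)
  also have "(\<lambda>x. carrier (OMap G b) #>\<^bsub>OMap G b\<^esub> AMap G h x) ` carrier (OMap G a) = {carrier (OMap G b)}"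
    using G.H.coset_join2[OF _ G.H.subgroup_self] G.one_closed G.hom_closed G.G.one_closed by blast
  finally have "AMap ?S h \<one>\<^bsub>OMap ?S a\<^esub> = \<one>\<^bsub>OMap ?S b\<^esub>" using one ob by simp
  moreover have "\<one>\<^bsub>OMap ?S c\<^esub> \<otimes>\<^bsub>OMap ?S c\<^esub> \<one>\<^bsub>OMap ?S c\<^esub> = \<one>\<^bsub>OMap ?S c\<^esub>" if "c \<in> Ob A" for c
    using *(2)[OF that] monoid.l_one[OF group.is_monoid] by (force simp: trivial_group_def)
  ultimately show ?thesis
    using *(2)[OF ob(1)] *(2)[OF ob(2)] ob
    by (simp add: trivial_group_def group_hom_def group_hom_axioms_def hom_def)
qed

section \<open>The two equivalences\<close>

lemma stable_zero_iff_right_exact: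
  assumes "half_exact A W G"
  shows "zero_functor A (stable_functor A W G) \<longleftrightarrow> right_exact A W G"
proof
  assume zero: "zero_functor A (stable_functor A W G)"
  show "right_exact A W G" unfolding right_exact_def
  proof (intro allI impI)
    fix f g assume fg: "Hom_short_exact A W f g"
    then have "is_kernel A f g" by (simp add: Hom_short_exact_def short_exact_iff)
    then have g: "g \<in> hom_set A (Src A g) (Tgt A g)" using kernel_arr by blast
    have N: "Tgt A g \<in> Ob A" using hom_Ob[OF g] by simp
    define d where "d = resolution A W (Tgt A g) 0"
    have d: "precover A W d" "Tgt A d = Tgt A g" using resolution_precover[OF N] by (auto simp: d_def)
    then have dh: "d \<in> hom_set A (Src A d) (Tgt A g)" "Src A d \<in> W" by (auto simp: precover_def hom_set_iff)
    \<comment> \<open>The source of \<open>d\<close> lies in \<open>W\<close>, so the precover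
      \<open>d\<close> lifts along \<open>g\<close>; the image of \<open>G d\<close>, which is
      everything, then lies in the image of \<open>G g\<close>.\<close>
    have "Comp A g \<in> epi (hom_grp A (Src A d) (Src A g)) (hom_grp A (Src A d) (Tgt A g))"
      using fg dh(2) short_exact_sequenceD unfolding Hom_short_exact_def by blast
    then obtain u where u: "u \<in> hom_set A (Src A d) (Src A g)" "g \<cdot> u = d"
      using dh(1) by (force simp: epi_def)
    have "carrier (OMap G (Tgt A g)) = AMap G d ` carrier (OMap G (Src A d))"
      using zero N stable_trivial_iff[OF d] by (simp add: zero_functor_def)
    also have "\<dots> \<subseteq> AMap G g ` carrier (OMap G (Src A g))" using AMap_image_factor[OF u(1) g] u(2) by simp
    finally have "AMap G g ` carrier (OMap G (Src A g)) = carrier (OMap G (Tgt A g))"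
      using group_hom.hom_closed[OF AMap_group_hom[OF g]] by blast
    then show "right_exact_seq (OMap G (Tgt A g)) (OMap G (Src A g)) (OMap G (Src A f)) (AMap G g) (AMap G f)"
      using assms fg by (simp add: right_exact_seq_iff half_exact_def)
  qed
next
  assume rx: "right_exact A W G"
  show "zero_functor A (stable_functor A W G)" unfolding zero_functor_def
  proof
    fix N assume N: "N \<in> Ob A"
    obtain k p where kp: "short_exact A k p" "Tgt A p = N" "precover A W p" "Hom_short_exact A W k p"
      using special_precovering_obtain[OF special_precovering N] .
    \<comment> \<open>Right exactness on the sequence of a special precover makes \<open>G p\<close>
      surjective, so its cokernel, the stable value at \<open>N\<close>, is trivial.\<close>
    then have "AMap G p ` carrier (OMap G (Src A p)) = carrier (OMap G N)"
      using rx by (auto simp: right_exact_def right_exact_seq_iff)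
    then show "trivial_group (OMap (stable_functor A W G) N)" using stable_trivial_iff kp by blast
  qed
qed

text \<open>For a special precover \<open>p\<close> of \<open>N\<close>, right exactness makes the
  value at \<open>N\<close> an image of the value at \<open>Src A p\<close>, which is trivial
  because this source lies in \<open>W\<close>. Conversely, a sequence of trivial groups and
  homomorphisms is exact.\<close>

lemma stable_right_exact_iff_zero:
  "right_exact A W (stable_functor A W G) \<longleftrightarrow> zero_functor A (stable_functor A W G)" (is "right_exact A W ?S \<longleftrightarrow> _")
proof
  assume rx: "right_exact A W ?S"
  show "zero_functor A ?S" unfolding zero_functor_def
  proof
    fix N assume N: "N \<in> Ob A"
    obtain k p where kp: "short_exact A k p" "Tgt A p = N" "precover A W p" "Hom_short_exact A W k p"
      using special_precovering_obtain[OF special_precovering N] .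
    then have r: "exact_seq ([OMap ?S N, OMap ?S (Src A p), OMap ?S (Src A k)], [AMap ?S p, AMap ?S k])"
       and s: "AMap ?S p ` carrier (OMap ?S (Src A p)) = carrier (OMap ?S N)"
      using rx by (auto simp: right_exact_def right_exact_seq_iff)
    have "group_hom (OMap ?S (Src A p)) (OMap ?S N) (AMap ?S p)"
      using exact_seq_imp_group_hom[where G = "OMap ?S (Src A p)" and l = "[OMap ?S (Src A k)]" and q = "[AMap ?S k]"] r by simp
    moreover have "trivial_group (OMap ?S (Src A p))"
      using stable_trivial_on_W kp(3) by (simp add: precover_def)
    ultimately show "trivial_group (OMap ?S N)"
      using s group_hom.image_from_trivial_group unfolding trivial_group_def group_hom_def by metis
  qed
next
  assume zero: "zero_functor A ?S"
  show "right_exact A W ?S" unfolding right_exact_def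
  proof (intro allI impI)
    fix f g assume "Hom_short_exact A W f g"
    then have ker: "is_kernel A f g" by (simp add: Hom_short_exact_def short_exact_iff)
    note f = kernel_arr(1)[OF ker] and g = kernel_arr(2)[OF ker]
    note F = AMap_stable_group_hom[OF f zero] and H = AMap_stable_group_hom[OF g zero]
    have t: "trivial_group (OMap ?S (Src A f))" "trivial_group (OMap ?S (Src A g))" "trivial_group (OMap ?S (Tgt A g))"
      using zero hom_Ob[OF f] hom_Ob[OF g] by (auto simp: zero_functor_def)
    show "right_exact_seq (OMap ?S (Tgt A g)) (OMap ?S (Src A g)) (OMap ?S (Src A f)) (AMap ?S g) (AMap ?S f)"
      using F H t group_hom.image_from_trivial_group[OF F t(1)] group_hom.image_from_trivial_group[OF H t(2)]
        group_hom.kernel_from_trivial_group[OF H t(2)]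
      by (simp add: right_exact_seq_iff trivial_group_def group_hom_def group_hom_axioms_def)
  qed
qed

end

theorem proposition2p17:
  fixes A :: "('o, 'm) ab_cat"
    and W :: "'o set"
    and G :: "('o, 'm, 'g) ab_functor"
  assumes "abelian_category A"
    and "special_precovering A W"
    and "additive_functor A G"
    and "half_exact A W G"
  shows "(right_exact A W (stable_functor A W G) \<longleftrightarrow> zero_functor A (stable_functor A W G)) \<and>
         (zero_functor A (stable_functor A W G) \<longleftrightarrow> right_exact A W G)"
proof -
  interpret abelian_category A by fact
  interpret additive_functor_special_precovering A W G
    by standard fact+
  show ?thesis using stable_right_exact_iff_zero stable_zero_iff_right_exact[OF assms(4)] by blast
qed

end
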